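(* Let $G$ be a unicyclic graph whose unique cycle is the odd cycle $C_{2n+1}=(x_1,\ldots,x_{2n+1})$, $n\ge 1$, such that every vertex of $G$ lies in $N_G[V(C_{2n+1})]$. Let $I=I(G)$ be its edge ideal and let $l=|E(G)\setminus E(C_{2n+1})|$. Let $s\in\mathbb{N}$ with $s\ge n+1$ and write $s=k(n+1)+r$ with $k\in\mathbb{Z}$ and $0\le r\le n$. Then the Hilbert function $h$ of the graded module $I^{(s)}/I^s$ is given by $$h(2s-k+i)=\binom{2n+l+s-(k-i)(n+1)}{s-(k-i)(n+1)}\qquad\text{for } 0\le i\le k-1,$$ and $h(d)=0$ for all other degrees $d$.
   Context: A unicyclic graph is a finite simple connected graph containing exactly one cycle. $R=\mathbb{K}[V(G)]$ is the standard graded polynomial ring over a field $\mathbb{K}$ whose variables are the vertices of $G$; the edge ideal is $I(G)=\langle uv : \{u,v\}\in E(G)\rangle\subset R$. The $s$-th symbolic power of $I$ is $I^{(s)}=\bigcap_{p\in\operatorname{Ass} I}(I^sR_p\cap R)$. For $W\subseteq V(G)$, $N_G[W]$ is the union of $W$ with the set of all vertices adjacent to some vertex of $W$. The Hilbert function of a finitely generated graded $R$-module $M=\bigoplus_i M_i$ is $h(d)=\dim_{\mathbb{K}}M_d$. *)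

theory Defs
  imports
    "HOL-Library.Poly_Mapping"
    "HOL-Algebra.QuotRing"
    "HOL-Algebra.Ideal_Product"
    "Jordan_Normal_Form.VS_Connect"
begin

section \<open>Finite simple graphs\<close>

text \<open>The vertex set of a graph is a finite type \<open>'v\<close>; the graph is given by its set \<open>E\<close>
  of edges, which are two-element sets of vertices.\<close>

definition simple_graph :: "'v::finite set set \<Rightarrow> bool" where
  "simple_graph E \<longleftrightarrow> (\<forall>e\<in>E. card e = 2)"

definition graph_connected :: "'v::finite set set \<Rightarrow> bool" where
  "graph_connected E \<longleftrightarrow> (\<forall>u v. (u, v) \<in> {(a, b). {a, b} \<in> E}\<^sup>*)"

definition cycle_edges :: "'v list \<Rightarrow> 'v set set" where
  "cycle_edges xs = {{xs ! i, xs ! ((i + 1) mod length xs)} | i. i < length xs}"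

definition is_cycle :: "'v set set \<Rightarrow> 'v list \<Rightarrow> bool" where
  "is_cycle E xs \<longleftrightarrow> 3 \<le> length xs \<and> distinct xs \<and> cycle_edges xs \<subseteq> E"

text \<open>A cycle, as a subgraph, has many representations by a vertex list (rotations and
  reversals) but is determined by its edge set, so cycles are counted by their edge sets.\<close>

definition unicyclic :: "'v::finite set set \<Rightarrow> bool" where
  "unicyclic E \<longleftrightarrow> simple_graph E \<and> graph_connected E \<and>
     (\<exists>!C. \<exists>xs. is_cycle E xs \<and> C = cycle_edges xs)"

definition closed_nbhd :: "'v set set \<Rightarrow> 'v set \<Rightarrow> 'v set" where
  "closed_nbhd E W = W \<union> {v. \<exists>w\<in>W. {v, w} \<in> E}"


section \<open>Symbolic powers\<close>

text \<open>The fraction \<open>a/u\<close> as an element of the localization at the prime \<open>p\<close>: the class of the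
  pair \<open>(a, u)\<close>, where \<open>(a, u)\<close> and \<open>(b, v)\<close> are identified iff \<open>t (a v - b u) = 0\<close>
  for some \<open>t\<close> outside \<open>p\<close>.\<close>

definition local_frac :: "'a::comm_ring_1 set \<Rightarrow> 'a \<Rightarrow> 'a \<Rightarrow> ('a \<times> 'a) set" where
  "local_frac p a u = {(b, v). v \<notin> p \<and> (\<exists>t. t \<notin> p \<and> t * (a * v - b * u) = 0)}"

definition local_extension :: "'a::comm_ring_1 set \<Rightarrow> 'a set \<Rightarrow> ('a \<times> 'a) set set" where
  "local_extension p J = {local_frac p a u | a u. a \<in> J \<and> u \<notin> p}"

definition local_contraction :: "'a::comm_ring_1 set \<Rightarrow> ('a \<times> 'a) set set \<Rightarrow> 'a set" where
  "local_contraction p L = {f. local_frac p f 1 \<in> L}"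

text \<open>\<open>Ass I\<close> means the associated primes of the module \<open>R/I\<close>, i.e. the primes that are
  annihilators of a residue class \<open>f + I\<close>.\<close>

definition associated_primes :: "'a::comm_ring_1 set \<Rightarrow> 'a set set" where
  "associated_primes I = {p. primeideal p class_ring \<and> (\<exists>f. p = {g. g * f \<in> I})}"

definition ideal_power :: "'a::comm_ring_1 set \<Rightarrow> nat \<Rightarrow> 'a set" where
  "ideal_power I s = I [^]\<^bsub>ideals_set class_ring\<^esub> s"

definition symbolic_power :: "'a::comm_ring_1 set \<Rightarrow> nat \<Rightarrow> 'a set" where
  "symbolic_power I s =
     (\<Inter>p\<in>associated_primes I. local_contraction p (local_extension p (ideal_power I s)))"


section \<open>Polynomials and edge ideals\<close>

text \<open>Polynomials over \<open>'k\<close> in the variables \<open>'v\<close>: finitely supported maps from exponent vectors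
  to coefficients; the product of \<^typ>\<open>_ \<Rightarrow>\<^sub>0 _\<close> is the convolution product.\<close>

type_synonym ('v, 'k) mpoly = "('v \<Rightarrow>\<^sub>0 nat) \<Rightarrow>\<^sub>0 'k"

definition var :: "'v \<Rightarrow> ('v, 'k::field) mpoly" where
  "var v = Poly_Mapping.single (Poly_Mapping.single v 1) 1"

definition const :: "'k \<Rightarrow> ('v, 'k::field) mpoly" where
  "const c = Poly_Mapping.single 0 c"

definition homogeneous :: "nat \<Rightarrow> ('v::finite, 'k::field) mpoly \<Rightarrow> bool" where
  "homogeneous d f \<longleftrightarrow>
     (\<forall>m \<in> Poly_Mapping.keys f. (\<Sum>v\<in>UNIV. Poly_Mapping.lookup m v) = d)"

definition edge_ideal :: "'v set set \<Rightarrow> ('v, 'k::field) mpoly set" where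
  "edge_ideal E = Idl\<^bsub>class_ring\<^esub> {var u * var v | u v. {u, v} \<in> E}"


section \<open>The Hilbert function of a quotient of homogeneous ideals\<close>

text \<open>For homogeneous ideals \<open>I \<subseteq> J\<close>, the degree \<open>d\<close> component of the graded module \<open>J/I\<close>, as
  a vector space over \<open>'k\<close>: the residue classes modulo \<open>I\<close> of the degree \<open>d\<close> elements of \<open>J\<close>.
  The record fields \<open>mult\<close> and \<open>one\<close> play no role for modules.\<close>

definition quotient_component ::
  "('v::finite, 'k::field) mpoly set \<Rightarrow> ('v, 'k) mpoly set \<Rightarrow> nat
     \<Rightarrow> ('k, ('v, 'k) mpoly set) module" where
  "quotient_component J I d =
    \<lparr> carrier = {I +>\<^bsub>class_ring\<^esub> f | f. f \<in> J \<and> homogeneous d f},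
      mult = undefined, one = undefined,
      zero = I, add = set_add class_ring,
      smult = (\<lambda>c A. \<Union>a\<in>A. I +>\<^bsub>class_ring\<^esub> (const c * a)) \<rparr>"

definition hilbert_fun ::
  "('v::finite, 'k::field) mpoly set \<Rightarrow> ('v, 'k) mpoly set \<Rightarrow> nat \<Rightarrow> nat" where
  "hilbert_fun J I d = vectorspace.dim class_ring (quotient_component J I d)"

end

theory Submission
  imports Defs
begin

text \<open>
  The graph is the odd cycle with pendant vertices attached. Localizing at the primes generated by
  minimal vertex covers shows that every monomial of the symbolic power has weight at least \<open>s\<close> on
  every vertex cover. Let \<open>c\<close> be the product of the cycle variables. A min-max argument (split off
  edges as long as the cover number drops by one only; when this is impossible the monomial is a
  power of \<open>c\<close>) writes such a monomial as a multiple of \<open>c\<^sup>j\<close> times a product of \<open>t\<close> edges with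
  \<open>t + j (n + 1) \<ge> s\<close>. Since every vertex is adjacent to the cycle, \<open>c\<close> times any variable is a
  product of \<open>n + 1\<close> edges, so the monomials outside the ordinary power are exactly \<open>c\<^sup>j\<close> times a
  product of \<open>s - j (n + 1)\<close> edges with \<open>j \<ge> 1\<close>, of degree \<open>2 s - j\<close>. The unique cycle is odd, so
  products of edges have unique factorizations, and the count is one of multisets of edges.
\<close>

text \<open>The number \<open>n + 1\<close> is the cover number of the odd cycle, while only
  \<open>n\<close> disjoint edges fit into it. This gap is the whole difference between the two
  powers. The associated primes of the edge ideal are never classified. For the necessary condition
  the primes of minimal covers suffice. For the converse it is enough that every associated prime
  omits some variable: multiplying by a power of that variable turns all factors \<open>c\<close>
  into edges. The hard point of the min-max argument is that a monomial without a removable edge has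
  equal exponents on the cycle. The covers that obstruct removal are only known to exist, so they
  are modified along arcs and compared through alternating sums. The linear algebra is free of
  computation: terms of the ordinary power have degree at least \<open>2 * s\<close>, the additional
  monomials have smaller degree, and the degree determines the exponent of \<open>c\<close>. A fixed
  exponent leaves the multisets of size t over \<open>2 * n + 1 + l\<close> edges, hence the
  binomial coefficient of \<open>2 * n + l + t\<close> over t.\<close>

abbreviation lookup where "lookup \<equiv> Poly_Mapping.lookup"
abbreviation single where "single \<equiv> Poly_Mapping.single"
abbreviation keys where "keys \<equiv> Poly_Mapping.keys"

section \<open>Squarefree monomials and vertex covers\<close>

definition set_mono :: "'v::finite set \<Rightarrow> 'v \<Rightarrow>\<^sub>0 nat" where
  "set_mono e = (\<Sum>v\<in>e. single v 1)"

definition mset_mono :: "'v::finite set multiset \<Rightarrow> 'v \<Rightarrow>\<^sub>0 nat" where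
  "mset_mono A = (\<Sum>e\<in>#A. set_mono e)"

text \<open>For a vertex cover \<open>W\<close> this is the largest exponent such that the
  corresponding power of the ideal generated by the variables of \<open>W\<close> contains the
  monomial; for \<open>W = UNIV\<close> it is the total degree.\<close>

definition wdeg :: "'v::finite set \<Rightarrow> ('v \<Rightarrow>\<^sub>0 nat) \<Rightarrow> nat" where
  "wdeg W m = (\<Sum>v\<in>W. lookup m v)"

definition vertex_cover :: "'v set set \<Rightarrow> 'v set \<Rightarrow> bool" where
  "vertex_cover E W \<longleftrightarrow> (\<forall>e\<in>E. e \<inter> W \<noteq> {})"

lemma lookup_set_mono: "lookup (set_mono e) v = (if v \<in> e then 1 else 0)"
  by (simp add: set_mono_def lookup_sum lookup_single when_def)

lemma mset_mono_empty [simp]: "mset_mono {#} = 0"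
  by (simp add: mset_mono_def)

lemma mset_mono_add_mset [simp]: "mset_mono (add_mset e A) = set_mono e + mset_mono A"
  by (simp add: mset_mono_def)

lemma mset_mono_union [simp]: "mset_mono (A + B) = mset_mono A + mset_mono B"
  by (simp add: mset_mono_def)

lemma lookup_mset_mono:
  assumes "set_mset A \<subseteq> F"
  shows "lookup (mset_mono A) v = (\<Sum>e\<in>F. if v \<in> e then count A e else 0)"
  using assms
proof (induction A)
  case (add e A)
  have "(\<Sum>e'\<in>F. if v \<in> e' then count (add_mset e A) e' else 0)
      = (\<Sum>e'\<in>F. (if e' = e then if v \<in> e' then 1 else 0 else 0) + (if v \<in> e' then count A e' else 0))"
    by (intro sum.cong) auto
  then show ?case
    using add by (simp add: sum.distrib lookup_add lookup_set_mono)
qed simp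

lemma lookup_mset_mono_replicate: "lookup (mset_mono (replicate_mset j e)) v = (if v \<in> e then j else 0)"
  by (induction j) (auto simp: lookup_add lookup_set_mono)

lemma wdeg_add [simp]: "wdeg W (m + m') = wdeg W m + wdeg W m'"
  by (simp add: wdeg_def lookup_add sum.distrib)

lemma wdeg_zero [simp]: "wdeg W 0 = 0"
  by (simp add: wdeg_def)

lemma wdeg_set_mono: "wdeg W (set_mono e) = card (W \<inter> e)"
  by (simp add: wdeg_def lookup_set_mono sum.If_cases)

lemma wdeg_eq_0_iff: "wdeg W m = 0 \<longleftrightarrow> (\<forall>v\<in>W. lookup m v = 0)"
  by (simp add: wdeg_def)

lemma set_mono_divides:
  assumes "\<And>v. v \<in> e \<Longrightarrow> 0 < lookup m v"
  obtains m' where "m = set_mono e + m'"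
proof
  show "m = set_mono e + (m - set_mono e)"
  proof (rule poly_mapping_eqI)
    fix v
    show "lookup m v = lookup (set_mono e + (m - set_mono e)) v"
      using assms[of v] by (auto simp: lookup_add lookup_minus lookup_set_mono)
  qed
qed

text \<open>An edge can be split off \<open>m\<close> without losing more than one from the cover number when
  every cover that contains both of its ends has weight above \<open>s\<close>.\<close>

definition removable :: "'v::finite set set \<Rightarrow> ('v \<Rightarrow>\<^sub>0 nat) \<Rightarrow> nat \<Rightarrow> 'v set \<Rightarrow> bool" where
  "removable E m s e \<longleftrightarrow> e \<in> E \<and> (\<forall>v\<in>e. 0 < lookup m v) \<and>
     (\<forall>W. vertex_cover E W \<longrightarrow> e \<subseteq> W \<longrightarrow> s < wdeg W m)"

text \<open>If \<open>u\<close> is the only neighbour of \<open>v\<close> that divides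
  \<open>m\<close>, a cover containing both may drop \<open>v\<close> and take in all vertices of
  exponent 0 instead. Its weight falls by the exponent of \<open>v\<close>, so it exceeded
  \<open>s\<close> before.\<close>

lemma removable_pendant:
  assumes cov: "\<And>W. vertex_cover E W \<Longrightarrow> s \<le> wdeg W m"
    and "{u, v} \<in> E" "u \<noteq> v" "0 < lookup m u" "0 < lookup m v"
    and E2: "\<And>e. e \<in> E \<Longrightarrow> card e = 2"
    and nb: "\<And>w. {v, w} \<in> E \<Longrightarrow> w \<noteq> u \<Longrightarrow> lookup m w = 0"
  shows "removable E m s {u, v}"
  unfolding removable_def
proof (intro conjI allI impI)
  fix W assume W: "vertex_cover E W" "{u, v} \<subseteq> W"
  define W' where "W' = (W - {v}) \<union> ({w. lookup m w = 0} - W)"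
  have "vertex_cover E W'"
    unfolding vertex_cover_def
  proof
    fix e assume e: "e \<in> E"
    obtain a where a: "a \<in> e" "a \<in> W"
      using W e unfolding vertex_cover_def by blast
    obtain b where b: "e = {a, b}" "a \<noteq> b"
      using E2[OF e] a(1) by (metis card_2_iff doubleton_eq_iff insert_iff empty_iff)
    show "e \<inter> W' \<noteq> {}"
    proof (cases "a = v")
      case True
      show ?thesis
        using b e nb[of b] W(2) assms(3) unfolding True W'_def by (cases "b = u") auto
    qed (use a in \<open>auto simp: W'_def\<close>)
  qed
  then have "s \<le> wdeg W' m" by (rule cov)
  also have "wdeg W' m = wdeg (W - {v}) m"
    unfolding W'_def wdeg_def by (subst sum.union_disjoint) auto
  also have "wdeg W m = lookup m v + wdeg (W - {v}) m"
    using W(2) unfolding wdeg_def by (subst sum.remove[of _ v]) auto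
  ultimately show "s < wdeg W m" using assms(5) by simp
qed (use assms in auto)

text \<open>A cover containing both ends of \<open>e\<close> loses two but had weight at least
  \<open>s + 1\<close>; any other cover loses at most one.\<close>

lemma removable_remove:
  assumes cov: "\<And>W. vertex_cover E W \<Longrightarrow> s \<le> wdeg W m"
    and rem: "removable E m s e" and "card e = 2" and m: "m = set_mono e + m'"
    and W: "vertex_cover E W"
  shows "s - 1 \<le> wdeg W m'"
proof (cases "e \<subseteq> W")
  case True
  then have "W \<inter> e = e" by auto
  then show ?thesis
    using rem W True assms(3) unfolding removable_def by (fastforce simp: m wdeg_set_mono)
next
  case False
  then have "W \<inter> e \<subset> e" by auto
  then have "card (W \<inter> e) < 2" using assms(3) by (metis psubset_card_mono finite)
  then show ?thesis using cov[OF W] by (simp add: m wdeg_set_mono)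
qed

section \<open>Odd cycles with whiskers\<close>

text \<open>The cycle is a periodic function on all natural numbers, so that an arc can start at any
  index and run past the end of a vertex list. All other vertices are leaves attached to the cycle;
  no reference to uniqueness of cycles remains.\<close>

locale whiskered_odd_cycle =
  fixes E :: "'v::finite set set" and x :: "nat \<Rightarrow> 'v" and n :: nat
  assumes n_pos: "1 \<le> n"
    and x_periodic: "x (i + (2 * n + 1)) = x i"
    and x_inj: "inj_on x {..2 * n}"
    and cycle_edge: "{x i, x (Suc i)} \<in> E"
    and edge_cases: "e \<in> E \<Longrightarrow> (\<exists>i. e = {x i, x (Suc i)}) \<or> (\<exists>y i. y \<notin> range x \<and> e = {y, x i})"
    and leaf_unique: "y \<notin> range x \<Longrightarrow> {y, u} \<in> E \<Longrightarrow> {y, u'} \<in> E \<Longrightarrow> u = u'"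
    and leaf_ex: "y \<notin> range x \<Longrightarrow> \<exists>i. {y, x i} \<in> E"
begin

lemma x_mod: "x (i mod (2 * n + 1)) = x i"
proof -
  have "x (r + q * (2 * n + 1)) = x r" for r q
    by (induction q) (simp, metis x_periodic add.assoc add.commute mult_Suc)
  from this[of "i mod (2 * n + 1)" "i div (2 * n + 1)"] show ?thesis
    by (metis mod_div_mult_eq)
qed

lemma x_eq_iff: "x i = x j \<longleftrightarrow> i mod (2 * n + 1) = j mod (2 * n + 1)"
proof -
  have "i mod (2 * n + 1) \<in> {..2 * n}" for i
    using mod_less_divisor[of "2 * n + 1" i] by (simp del: mod_less_divisor)
  then show ?thesis
    using x_inj x_mod unfolding inj_on_def by metis
qed

lemma inj_on_shift: "inj_on (\<lambda>q. x (i + q)) {..2 * n}"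
proof (rule inj_onI)
  fix a b assume ab: "a \<in> {..2 * n}" "b \<in> {..2 * n}" "x (i + a) = x (i + b)"
  then have "(i + a) mod (2 * n + 1) = (i + b) mod (2 * n + 1)"
    using x_eq_iff by blast
  then have "(int i + int a) mod int (2 * n + 1) = (int i + int b) mod int (2 * n + 1)"
    by (metis of_nat_add of_nat_mod)
  then have "int a mod int (2 * n + 1) = int b mod int (2 * n + 1)"
    by (metis add_diff_cancel_left' mod_diff_left_eq)
  then have "a mod (2 * n + 1) = b mod (2 * n + 1)"
    by (metis of_nat_eq_iff of_nat_mod)
  then show "a = b" using ab by (simp add: le_imp_less_Suc)
qed

lemma range_shift: "range x = (\<lambda>q. x (i + q)) ` {..2 * n}"
proof (rule sym, rule card_seteq)
  have "range x \<subseteq> x ` {..2 * n}"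
  proof
    fix v assume "v \<in> range x"
    then obtain j where "v = x j" by auto
    then have "v = x (j mod (2 * n + 1))" using x_mod by metis
    moreover have "j mod (2 * n + 1) < 2 * n + 1" by simp
    ultimately show "v \<in> x ` {..2 * n}" by (metis atMost_iff imageI less_Suc_eq_le Suc_eq_plus1)
  qed
  then have "card (range x) \<le> 2 * n + 1"
    by (metis card_atMost card_image x_inj card_mono finite Suc_eq_plus1)
  then show "card (range x) \<le> card ((\<lambda>q. x (i + q)) ` {..2 * n})"
    by (simp add: card_image[OF inj_on_shift])
qed auto

lemma range_shiftE:
  assumes "v \<in> range x"
  obtains q where "q \<le> 2 * n" "v = x (i + q)"
  using assms range_shift[of i] by auto

lemma card_range_x: "card (range x) = 2 * n + 1"
  using card_image[OF x_inj] range_shift[of 0] by simp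

lemma x_Suc_neq: "x i \<noteq> x (Suc i)"
  using inj_on_eq_iff[OF inj_on_shift[of i], of 0 1] n_pos by auto

lemma card_edge: "e \<in> E \<Longrightarrow> card e = 2"
  using edge_cases[of e] x_Suc_neq by (metis card_2_iff rangeI)

lemma sum_cycle: "(\<Sum>v\<in>range x. g v) = (\<Sum>q\<le>2 * n. g (x (i + q)))"
  using sum.reindex[OF inj_on_shift[of i], of g] range_shift[of i] by (simp add: o_def)

lemma wdeg_cycle:
  assumes "\<And>v. v \<notin> range x \<Longrightarrow> lookup m v = 0"
  shows "wdeg W m = (\<Sum>q\<le>2 * n. if x (i + q) \<in> W then lookup m (x (i + q)) else 0)"
proof -
  have "wdeg W m = (\<Sum>v\<in>UNIV. if v \<in> W then lookup m v else 0)"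
    by (simp add: wdeg_def sum.If_cases)
  also have "\<dots> = (\<Sum>v\<in>range x. if v \<in> W then lookup m v else 0)"
    by (rule sum.mono_neutral_right) (use assms in auto)
  finally show ?thesis by (simp add: sum_cycle[of _ i])
qed

text \<open>All leaves lie in \<open>W\<close> and so cover the pendant edges, at no cost for a
  monomial supported on the cycle. What remains is one turn of cycle edges, started wherever
  convenient.\<close>

lemma cover_shiftI:
  assumes "- range x \<subseteq> W" and "\<And>q. q \<le> 2 * n \<Longrightarrow> x (i + q) \<in> W \<or> x (i + Suc q) \<in> W"
  shows "vertex_cover E W"
  unfolding vertex_cover_def
proof
  fix e assume "e \<in> E"
  then consider j where "e = {x j, x (Suc j)}" | y j where "y \<notin> range x" "e = {y, x j}"
    using edge_cases by blast
  then show "e \<inter> W \<noteq> {}"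
  proof cases
    case 1
    obtain q where q: "q \<le> 2 * n" "x j = x (i + q)"
      using range_shiftE[of "x j" i] by auto
    then have "x (Suc j) = x (i + Suc q)"
      unfolding x_eq_iff by (metis mod_Suc_eq add_Suc_right)
    then show ?thesis using assms(2)[OF q(1)] q 1 by auto
  qed (use assms(1) in auto)
qed

text \<open>Exchanging the two alternating halves of the arc gives another cover, whose weight is also
  at least \<open>s\<close>.\<close>

lemma flip_arc:
  assumes cov: "\<And>W. vertex_cover E W \<Longrightarrow> s \<le> wdeg W m"
    and leaves: "\<And>v. v \<notin> range x \<Longrightarrow> lookup m v = 0"
    and W: "vertex_cover E W" "wdeg W m \<le> s" and p: "p < 2 * n"
    and ends: "x (i + 2 * n) \<in> W" "x (i + Suc p) \<in> W"
    and alt: "\<And>q. q \<le> p \<Longrightarrow> x (i + q) \<in> W \<longleftrightarrow> even q"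
  shows "(\<Sum>q\<le>p. (-1) ^ q * int (lookup m (x (i + q)))) \<le> 0"
proof -
  define g where "g q = lookup m (x (i + q))" for q
  define W' where "W' = - range x \<union> {x (i + q) | q. q \<le> 2 * n \<and> (if q \<le> p then odd q else x (i + q) \<in> W)}"
  have W': "x (i + q) \<in> W' \<longleftrightarrow> (if q \<le> p then odd q else x (i + q) \<in> W)" if "q \<le> 2 * n" for q
  proof -
    have "x (i + q') = x (i + q) \<longleftrightarrow> q' = q" if "q' \<le> 2 * n" for q'
      using inj_on_eq_iff[OF inj_on_shift[of i]] that \<open>q \<le> 2 * n\<close> by simp
    then show ?thesis using that unfolding W'_def by fastforce
  qed
  have "vertex_cover E W'"
  proof (rule cover_shiftI[where i = i])
    \<comment> \<open>Inside the arc parity covers the edge, outside it \<open>W\<close> does. The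
      two edges leaving the arc are covered by the vertices in \<open>ends\<close>, which the flip
      leaves alone.\<close>
    fix q assume q: "q \<le> 2 * n"
    have "x (i + q) \<in> W \<or> x (i + Suc q) \<in> W"
      using W(1) cycle_edge[of "i + q"] unfolding vertex_cover_def by auto
    moreover have "q = 2 * n \<or> Suc q \<le> 2 * n" using q by auto
    ultimately show "x (i + q) \<in> W' \<or> x (i + Suc q) \<in> W'"
      using W'[OF q] W'[of "Suc q"] ends p by (cases "q = p") (auto split: if_splits)
  qed (auto simp: W'_def)
  then have "s \<le> wdeg W' m" by (rule cov)
  with W(2) have "int (wdeg W m) \<le> int (wdeg W' m)" by simp
  have "int (wdeg U m) = (\<Sum>q\<le>2 * n. if x (i + q) \<in> U then int (g q) else 0)" for U
    unfolding wdeg_cycle[OF leaves, where i = i, simplified] g_def of_nat_sum by (intro sum.cong) auto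
  then have "int (wdeg W' m) - int (wdeg W m)
      = (\<Sum>q\<le>2 * n. (if x (i + q) \<in> W' then int (g q) else 0) - (if x (i + q) \<in> W then int (g q) else 0))"
    by (simp only: sum_subtractf)
  also have "\<dots> = (\<Sum>q\<le>2 * n. if q \<le> p then - ((-1) ^ q * int (g q)) else 0)"
    by (intro sum.cong) (auto simp: W' alt)
  also have "\<dots> = - (\<Sum>q\<le>p. (-1) ^ q * int (g q))"
  proof -
    have "{..2 * n} \<inter> {q. q \<le> p} = {..p}" using p by auto
    then show ?thesis by (simp add: sum.If_cases sum_negf)
  qed
  finally show ?thesis using \<open>int (wdeg W m) \<le> int (wdeg W' m)\<close> unfolding g_def by linarith
qed

definition alt_sum :: "('v \<Rightarrow>\<^sub>0 nat) \<Rightarrow> nat \<Rightarrow> int" where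
  "alt_sum m i = (\<Sum>q\<le>2 * n. (-1) ^ q * int (lookup m (x (i + q))))"

text \<open>\<open>alt_sum m i\<close> is twice the weight of the edge between \<open>x (i - 1)\<close> and \<open>x i\<close> in the unique
  rational edge weighting of the cycle whose vertex sums are the exponents of \<open>m\<close>.\<close>

lemma alt_sum_Suc: "alt_sum m i + alt_sum m (Suc i) = 2 * int (lookup m (x i))"
proof -
  define g where "g q = int (lookup m (x (i + q)))" for q
  have "(\<Sum>q\<le>N. (-1) ^ q * g q) + (\<Sum>q\<le>N. (-1) ^ q * g (Suc q)) = g 0 + (-1) ^ N * g (Suc N)" for N
    by (induction N) (auto simp: algebra_simps)
  from this[of "2 * n"] x_periodic[of i] show ?thesis
    by (simp add: alt_sum_def g_def)
qed

text \<open>The recurrence \<open>alt_sum_Suc\<close> telescopes along an arc; the inequality from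
  \<open>flip_arc\<close> thereby becomes a comparison of the two values at the ends of the
  arc.\<close>

lemma alt_sum_arc:
  "alt_sum m i + (-1) ^ p * alt_sum m (i + Suc p) = 2 * (\<Sum>q\<le>p. (-1) ^ q * int (lookup m (x (i + q))))"
proof (induction p)
  case (Suc p)
  have "alt_sum m (i + Suc (Suc p)) = 2 * int (lookup m (x (i + Suc p))) - alt_sum m (i + Suc p)"
    using alt_sum_Suc[of m "i + Suc p"] by simp
  then have "(-1) ^ Suc p * alt_sum m (i + Suc (Suc p))
    = (-1) ^ p * alt_sum m (i + Suc p) + 2 * ((-1) ^ Suc p * int (lookup m (x (i + Suc p))))"
    by (simp only:) (simp add: algebra_simps)
  then show ?case using Suc by (simp only: sum.atMost_Suc distrib_left)
qed (use alt_sum_Suc in simp)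

lemma alt_sum_mod: "alt_sum m (i mod (2 * n + 1)) = alt_sum m i"
proof -
  have "x (i mod (2 * n + 1) + q) = x (i + q)" for q
    unfolding x_eq_iff by (simp add: mod_add_left_eq)
  then show ?thesis by (simp add: alt_sum_def)
qed

text \<open>If a cover of weight \<open>s\<close> contains both ends of an edge with maximal \<open>alt_sum\<close>, flipping
  the arc up to the next edge inside the cover produces an edge with a larger \<open>alt_sum\<close>, unless
  the cover contains no other such edge; then flipping shows that a neighbouring value is maximal too.\<close>

lemma no_removable_imp_const:
  assumes cov: "\<And>W. vertex_cover E W \<Longrightarrow> s \<le> wdeg W m"
    and leaves: "\<And>v. v \<notin> range x \<Longrightarrow> lookup m v = 0"
    and pos: "\<And>i. 0 < lookup m (x i)"
    and nrem: "\<And>e. \<not> removable E m s e"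
  obtains M where "\<And>i. lookup m (x i) = M"
proof -
  define Z where "Z = Max (alt_sum m ` {..2 * n})"
  have max: "alt_sum m i \<le> Z" for i
  proof -
    have "i mod (2 * n + 1) \<in> {..2 * n}" using mod_less_divisor[of "2 * n + 1" i] by (simp del: mod_less_divisor)
    then have "alt_sum m (i mod (2 * n + 1)) \<le> Z" unfolding Z_def by (intro Max_ge) auto
    then show ?thesis by (simp only: alt_sum_mod)
  qed
  \<comment> \<open>\<open>i + 2 * n\<close> is the predecessor of \<open>i\<close> on the cycle:
    maximality of the value travels backwards.\<close>
  have step: "alt_sum m (i + 2 * n) = Z" if iZ: "alt_sum m i = Z" for i
  proof -
    have ei: "Suc (i + 2 * n) = i + (2 * n + 1)" by simp
    have e: "{x (i + 2 * n), x i} \<in> E"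
      using cycle_edge[of "i + 2 * n"] unfolding ei x_periodic .
    obtain W where W: "vertex_cover E W" "wdeg W m \<le> s" "x (i + 2 * n) \<in> W" "x i \<in> W"
      using nrem[of "{x (i + 2 * n), x i}"] e pos unfolding removable_def by (auto simp: not_less)
    define P where "P p \<longleftrightarrow> x (i + p) \<in> W \<and> x (i + Suc p) \<in> W" for p
    \<comment> \<open>The first cycle edge after \<open>x i\<close> with both ends in
      \<open>W\<close>. It exists because the edge from \<open>x (i + 2 * n)\<close> to
      \<open>x i\<close> is one, and before it \<open>W\<close> must alternate.\<close>
    define p where "p = (LEAST p. P p)"
    have "P (2 * n)" using W x_periodic[of i] by (simp add: P_def)
    then have Pp: "P p" and p: "p \<le> 2 * n" unfolding p_def by (auto intro: LeastI Least_le)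
    have alt: "x (i + q) \<in> W \<longleftrightarrow> even q" if "q \<le> p" for q
      using that
    proof (induction q)
      case (Suc q)
      then have "\<not> P q" using not_less_Least[of q P] by (simp add: p_def)
      then show ?case using Suc W(1) cycle_edge[of "i + q"] unfolding vertex_cover_def P_def by fastforce
    qed (use W in auto)
    have "even p" using alt[of p] Pp by (simp add: P_def)
    show ?thesis
    proof (cases "p = 2 * n")
      case True
      \<comment> \<open>The arc stops one vertex before a full turn, since
        \<open>x (i + 2 * n)\<close> must stay in the cover. Its last index is odd, so the two end
        values enter with opposite signs.\<close>
      have "(\<Sum>q\<le>2 * n - 1. (-1) ^ q * int (lookup m (x (i + q)))) \<le> 0"
        by (rule flip_arc[OF cov leaves W(1,2)]) (use W(3) n_pos alt True in auto)
      then have "alt_sum m i \<le> alt_sum m (i + 2 * n)"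
        using alt_sum_arc[of m i "2 * n - 1"] n_pos by simp
      then show ?thesis using max[of "i + 2 * n"] iZ by simp
    next
      case False
      \<comment> \<open>Here the end values enter with equal signs, so the value at
        \<open>i + Suc p\<close> is at most \<open>- Z\<close>. By the recurrence the next value is
        then at least \<open>Z\<close> plus twice a positive exponent, against maximality.\<close>
      have "(\<Sum>q\<le>p. (-1) ^ q * int (lookup m (x (i + q)))) \<le> 0"
        by (rule flip_arc[OF cov leaves W(1,2)]) (use W(3) Pp p alt False in \<open>auto simp: P_def\<close>)
      then have "alt_sum m i + alt_sum m (i + Suc p) \<le> 0"
        using alt_sum_arc[of m i p] \<open>even p\<close> by simp
      then show ?thesis
        using alt_sum_Suc[of m "i + Suc p"] pos[of "i + Suc p"] max[of "Suc (i + Suc p)"] iZ by linarith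
    qed
  qed
  obtain j where j: "j \<le> 2 * n" "alt_sum m j = Z"
    using Max_in[of "alt_sum m ` {..2 * n}"] unfolding Z_def by fastforce
  have steps: "alt_sum m (j + t * (2 * n)) = Z" for t
  proof (induction t)
    case (Suc t)
    then show ?case using step[OF Suc] by (simp add: algebra_simps)
  qed (use j in simp)
  have all: "alt_sum m i = Z" for i
  proof -
    obtain k where k: "2 * n = Suc k" using n_pos by (cases "2 * n") auto
    \<comment> \<open>As 2n is -1 modulo 2n+1, t steps of length 2n lead from \<open>j\<close> to j
      - t. The choice t = j + 2n i ends at -2n i, which is \<open>i\<close>.\<close>
    have "j + (j + Suc k * i) * Suc k = i + (Suc k + 1) * (j + k * i)"
      by (simp add: algebra_simps)
    then have "(j + (j + 2 * n * i) * (2 * n)) mod (2 * n + 1) = i mod (2 * n + 1)"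
      unfolding k by (simp only: mod_mult_self2)
    then show ?thesis using steps alt_sum_mod by metis
  qed
  have "lookup m (x i) = nat Z" for i
    using alt_sum_Suc[of m i] all by simp
  then show thesis by (rule that)
qed

end

section \<open>Decomposing monomials into edges and full cycles\<close>

lemma ex_submset_of_size:
  assumes "s \<le> size A"
  shows "\<exists>B. B \<subseteq># A \<and> size B = s"
proof -
  obtain xs where xs: "A = mset xs" by (metis ex_mset)
  have "mset (take s xs) \<subseteq># A"
    unfolding xs by (metis append_take_drop_id mset_append mset_subset_eq_add_left)
  then show ?thesis using assms xs by (metis length_take min.absorb2 size_mset)
qed

lemma set_mono_doubleton: "a \<noteq> b \<Longrightarrow> set_mono {a, b} = single a 1 + single b 1"
  by (simp add: set_mono_def)

lemma wdeg_mset_mono_ge: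
  assumes "set_mset A \<subseteq> E" "vertex_cover E W"
  shows "size A \<le> wdeg W (mset_mono A)"
  using assms(1)
proof (induction A)
  case (add e A)
  have "W \<inter> e \<noteq> {}" using add.prems assms(2) by (auto simp: vertex_cover_def)
  then have "0 < card (W \<inter> e)" by (simp add: card_gt_0_iff)
  then show ?case using add by (simp add: wdeg_set_mono)
qed simp

context whiskered_odd_cycle
begin

lemma x_Suc_eq_iff: "x (Suc i) = x (Suc j) \<longleftrightarrow> x i = x j"
proof
  assume "x (Suc i) = x (Suc j)"
  then have "(Suc i + 2 * n) mod (2 * n + 1) = (Suc j + 2 * n) mod (2 * n + 1)"
    unfolding x_eq_iff by (metis mod_add_left_eq)
  moreover have "Suc k + 2 * n = k + (2 * n + 1)" for k by simp
  ultimately show "x i = x j"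
    unfolding x_eq_iff by (simp only: mod_add_self2)
next
  assume "x i = x j"
  then show "x (Suc i) = x (Suc j)"
    unfolding x_eq_iff by (metis mod_Suc_eq)
qed

lemma x_add2_neq: "x i \<noteq> x (Suc (Suc i))"
  using inj_on_eq_iff[OF inj_on_shift[of i], of 0 2] n_pos by auto

lemma edge_at_cycle:
  assumes "{x (Suc i), w} \<in> E"
  shows "w = x i \<or> w = x (Suc (Suc i)) \<or> w \<notin> range x"
  using edge_cases[OF assms]
proof (elim disjE exE conjE)
  fix j assume "{x (Suc i), w} = {x j, x (Suc j)}"
  then consider "x (Suc i) = x j" "w = x (Suc j)" | "x (Suc i) = x (Suc j)" "w = x j"
    by (auto simp: doubleton_eq_iff)
  then show ?thesis by cases (use x_Suc_eq_iff[of "Suc i" j] x_Suc_eq_iff[of i j] in auto)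
qed (auto simp: doubleton_eq_iff)

text \<open>By \<open>removable_pendant\<close>, an edge inside the support of \<open>m\<close> can
  be continued at either end to a further vertex of the support. A leaf offers no continuation, so
  such an edge lies on the cycle, and continuing it fills the whole cycle. After that no leaf can be
  in the support.\<close>

lemma no_removable_support:
  assumes cov: "\<And>W. vertex_cover E W \<Longrightarrow> s \<le> wdeg W m"
    and nrem: "\<And>e. \<not> removable E m s e" and "0 < s"
  shows "0 < lookup m (x i)" and "v \<notin> range x \<Longrightarrow> lookup m v = 0"
proof -
  have pend: "\<exists>w. {v, w} \<in> E \<and> w \<noteq> u \<and> 0 < lookup m w"
    if "{u, v} \<in> E" "0 < lookup m u" "0 < lookup m v" for u v
  proof (rule ccontr)
    assume "\<nexists>w. {v, w} \<in> E \<and> w \<noteq> u \<and> 0 < lookup m w"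
    moreover have "u \<noteq> v" using card_edge[OF that(1)] by auto
    ultimately have "removable E m s {u, v}"
      using that cov card_edge by (intro removable_pendant) auto
    then show False using nrem by blast
  qed
  have leaf: "lookup m y = 0 \<or> lookup m u = 0" if y: "y \<notin> range x" "{y, u} \<in> E" for y u
  proof (rule ccontr)
    assume "\<not> ?thesis"
    then obtain w where "{y, w} \<in> E" "w \<noteq> u"
      using pend[of u y] y by (auto simp: insert_commute)
    then show False using leaf_unique[OF y(1)] y(2) by blast
  qed
  \<comment> \<open>The vertices of exponent 0 have total weight 0 < \<open>s\<close>, so they do
    not form a cover: some edge lies inside the support.\<close>
  have "\<not> vertex_cover E {v. lookup m v = 0}"
    using cov[of "{v. lookup m v = 0}"] \<open>0 < s\<close> by (auto simp: wdeg_def)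
  then have "\<exists>e\<in>E. e \<inter> {v. lookup m v = 0} = {}" by (simp add: vertex_cover_def)
  then obtain e where "e \<in> E" "e \<inter> {v. lookup m v = 0} = {}" by (rule bexE)
  then have e: "e \<in> E" "\<And>v. v \<in> e \<Longrightarrow> 0 < lookup m v" by auto
  obtain a where a: "0 < lookup m (x a)" "0 < lookup m (x (Suc a))"
  proof -
    have "e \<noteq> {y, x j}" if "y \<notin> range x" for y j
      using leaf[OF that, of "x j"] e(1) e(2)[of y] e(2)[of "x j"] by auto
    then obtain j where "e = {x j, x (Suc j)}" using edge_cases[OF e(1)] by blast
    then show thesis using that[of j] e(2) by simp
  qed
  have "0 < lookup m (x (a + t)) \<and> 0 < lookup m (x (a + Suc t))" for t
  proof (induction t)
    case (Suc t)
    obtain w where w: "{x (Suc (a + t)), w} \<in> E" "w \<noteq> x (a + t)" "0 < lookup m w"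
      using pend[OF cycle_edge[of "a + t"]] Suc by auto
    have "w \<in> range x"
      using leaf[of w "x (Suc (a + t))"] w Suc by (auto simp: insert_commute)
    then show ?case using edge_at_cycle[OF w(1)] w Suc by auto
  qed (use a in simp)
  then show pos: "0 < lookup m (x i)" for i
    using range_shiftE[of "x i" a] by (metis rangeI)
  show "lookup m v = 0" if "v \<notin> range x"
    using leaf_ex[OF that] leaf[OF that] pos by (metis less_irrefl)
qed

lemma sum_even: "(\<Sum>q\<le>2 * k. if even q then M else 0) = (k + 1) * (M::nat)"
  by (induction k) (auto simp: algebra_simps)

text \<open>The positions 0, 2, ..., 2n cover the odd cycle with \<open>n + 1\<close> vertices;
  \<open>x 0\<close> and \<open>x (2 * n)\<close> are adjacent, the one edge covered twice.\<close>

lemma const_cover: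
  assumes cov: "\<And>W. vertex_cover E W \<Longrightarrow> s \<le> wdeg W m"
    and leaves: "\<And>v. v \<notin> range x \<Longrightarrow> lookup m v = 0"
    and M: "\<And>i. lookup m (x i) = M"
  shows "s \<le> M * (n + 1)"
proof -
  define W where "W = - range x \<union> {x q | q. q \<le> 2 * n \<and> even q}"
  have W: "x q \<in> W \<longleftrightarrow> even q" if "q \<le> 2 * n" for q
    using inj_on_eq_iff[OF x_inj] that unfolding W_def by auto
  have "vertex_cover E W"
  proof (rule cover_shiftI[where i = 0])
    fix q assume "q \<le> 2 * n"
    then have "even q \<or> Suc q \<le> 2 * n" by (metis le_neq_implies_less Suc_leI dvd_triv_left)
    then show "x (0 + q) \<in> W \<or> x (0 + Suc q) \<in> W"
      using W[of q] W[of "Suc q"] \<open>q \<le> 2 * n\<close> by auto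
  qed (auto simp: W_def)
  then have "s \<le> wdeg W m" by (rule cov)
  also have "\<dots> = (\<Sum>q\<le>2 * n. if even q then M else 0)"
    unfolding wdeg_cycle[OF leaves, where i = 0, simplified] by (intro sum.cong) (auto simp: W M)
  also have "\<dots> = M * (n + 1)" by (simp only: sum_even mult.commute[of M])
  finally show ?thesis .
qed

text \<open>Induction on the degree: each split-off edge lowers the demand \<open>s\<close> by one,
  and the final stage without removable edges supplies the whole cycle part. A remainder
  \<open>m'\<close> survives only when the demand reaches 0 before that stage.\<close>

lemma covers_imp_decomposition:
  assumes "\<And>W. vertex_cover E W \<Longrightarrow> s \<le> wdeg W m"
  shows "\<exists>j A m'. set_mset A \<subseteq> E \<and> s \<le> size A + j * (n + 1) \<and>
           m = mset_mono (replicate_mset j (range x)) + mset_mono A + m'"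
  using assms
proof (induction "wdeg UNIV m" arbitrary: m s rule: less_induct)
  case less
  note cov = less.prems
  consider "s = 0" | e where "removable E m s e" | "0 < s" "\<And>e. \<not> removable E m s e" by auto
  then show ?case
  proof cases
    case 1
    then show ?thesis by (intro exI[of _ 0] exI[of _ "{#}"] exI[of _ m]) auto
  next
    case 2
    then have e: "e \<in> E" "\<And>v. v \<in> e \<Longrightarrow> 0 < lookup m v" by (auto simp: removable_def)
    obtain m' where m': "m = set_mono e + m'" using set_mono_divides[of e m] e(2) by blast
    have "wdeg UNIV m' < wdeg UNIV m"
      unfolding m' using card_edge[OF e(1)] by (simp add: wdeg_set_mono)
    moreover have "s - 1 \<le> wdeg W m'" if "vertex_cover E W" for W
      using removable_remove[OF cov 2 card_edge[OF e(1)] m' that] .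
    ultimately obtain j A m'' where IH: "set_mset A \<subseteq> E" "s - 1 \<le> size A + j * (n + 1)"
      "m' = mset_mono (replicate_mset j (range x)) + mset_mono A + m''"
      using less.hyps[of m' "s - 1"] by blast
    show ?thesis
      by (intro exI[of _ j] exI[of _ "add_mset e A"] exI[of _ m'']) (use IH e in \<open>auto simp: m' ac_simps\<close>)
  next
    case 3
    note supp = no_removable_support[OF cov 3(2,1)]
    obtain M where M: "\<And>i. lookup m (x i) = M"
      using no_removable_imp_const[OF cov supp(2) supp(1) 3(2)] by blast
    have "m = mset_mono (replicate_mset M (range x))"
      by (rule poly_mapping_eqI) (auto simp: lookup_mset_mono_replicate M supp(2))
    then show ?thesis
      using const_cover[OF cov supp(2) M]
      by (intro exI[of _ M] exI[of _ "{#}"] exI[of _ 0]) auto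
  qed
qed

text \<open>Without \<open>x i\<close> the cycle is a path on 2n vertices, which has a perfect
  matching.\<close>

lemma cycle_eq_edges_plus_vertex:
  "\<exists>A. set_mset A \<subseteq> E \<and> size A = n \<and> set_mono (range x) = mset_mono A + single (x i) 1"
proof -
  have "\<exists>A. set_mset A \<subseteq> E \<and> size A = k \<and> (\<Sum>q<2 * k. single (x (Suc i + q)) 1) = mset_mono A" for k
  proof (induction k)
    case (Suc k)
    then obtain A where A: "set_mset A \<subseteq> E" "size A = k"
      "(\<Sum>q<2 * k. single (x (Suc i + q)) 1) = mset_mono A" by blast
    then show ?case
      using cycle_edge[of "Suc i + 2 * k"] x_Suc_neq[of "Suc i + 2 * k"]
      by (intro exI[of _ "add_mset {x (Suc i + 2 * k), x (Suc (Suc i + 2 * k))} A"])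
        (auto simp: set_mono_doubleton ac_simps)
  qed simp
  then obtain A where A: "set_mset A \<subseteq> E" "size A = n"
    "(\<Sum>q<2 * n. single (x (Suc i + q)) 1) = mset_mono A" by blast
  have "set_mono (range x) = (\<Sum>q\<le>2 * n. single (x (Suc i + q)) 1)"
    unfolding set_mono_def by (rule sum_cycle)
  also have "\<dots> = mset_mono A + single (x (Suc i + 2 * n)) 1"
    by (simp only: A(3)[symmetric] lessThan_Suc_atMost[symmetric] sum.lessThan_Suc)
  also have "x (Suc i + 2 * n) = x i" using x_periodic[of i] by simp
  finally show ?thesis using A by blast
qed

lemma cycle_plus_vertex:
  "\<exists>A. set_mset A \<subseteq> E \<and> size A = n + 1 \<and> set_mono (range x) + single v 1 = mset_mono A"
proof -
  obtain i where i: "{v, x i} \<in> E"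
    using leaf_ex[of v] cycle_edge by blast
  then have "v \<noteq> x i" using card_edge[OF i] by auto
  obtain A where "set_mset A \<subseteq> E" "size A = n" "set_mono (range x) = mset_mono A + single (x i) 1"
    using cycle_eq_edges_plus_vertex by blast
  then show ?thesis
    using i \<open>v \<noteq> x i\<close> by (intro exI[of _ "add_mset {v, x i} A"]) (auto simp: set_mono_doubleton ac_simps)
qed

lemma single_divides:
  assumes "m \<noteq> (0 :: 'v \<Rightarrow>\<^sub>0 nat)"
  obtains v m' where "m = single v 1 + m'"
proof -
  obtain v where "0 < lookup m v"
    using assms by (metis gr0I lookup_zero poly_mapping_eqI)
  then show thesis using set_mono_divides[of "{v}" m] that by (auto simp: set_mono_def)
qed

text \<open>Any slack is used to trade a cycle for edges. A variable of \<open>m'\<close> together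
  with a cycle gives \<open>n + 1\<close> edges, keeping the count; if the count exceeds
  \<open>s\<close>, a cycle may be replaced by \<open>n\<close> edges and a vertex, losing one.
  Either the cycles run out or there was no slack.\<close>

lemma decomposition_cases:
  assumes "set_mset A \<subseteq> E" "s \<le> size A + j * (n + 1)"
    and "m = mset_mono (replicate_mset j (range x)) + mset_mono A + m'"
  shows "(\<exists>A m'. set_mset A \<subseteq> E \<and> size A = s \<and> m = mset_mono A + m') \<or>
    (\<exists>j A. 1 \<le> j \<and> set_mset A \<subseteq> E \<and> size A + j * (n + 1) = s \<and>
       m = mset_mono (replicate_mset j (range x)) + mset_mono A)"
  using assms
proof (induction j arbitrary: A m')
  case 0
  then obtain B where "B \<subseteq># A" "size B = s" using ex_submset_of_size[of s A] by auto
  then have "set_mset B \<subseteq> E" "m = mset_mono B + (mset_mono (A - B) + m')"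
    using 0 set_mset_mono[of B A] by (auto simp flip: mset_mono_union add.assoc)
  then show ?case using \<open>size B = s\<close> by blast
next
  case (Suc j)
  show ?case
  proof (cases "m' = 0")
    case False
    then obtain v m'' where v: "m' = single v 1 + m''" by (rule single_divides)
    obtain B where B: "set_mset B \<subseteq> E" "size B = n + 1" "set_mono (range x) + single v 1 = mset_mono B"
      using cycle_plus_vertex by blast
    have "m = mset_mono (replicate_mset j (range x)) + mset_mono (A + B) + m''"
      using Suc.prems(3) unfolding v by (simp add: B(3)[symmetric] ac_simps)
    then show ?thesis using Suc.IH[of "A + B" m''] Suc.prems B by simp
  next
    case m': True
    show ?thesis
    proof (cases "s = size A + Suc j * (n + 1)")
      case True
      then show ?thesis using Suc.prems m' by (intro disjI2 exI[of _ "Suc j"] exI[of _ A]) auto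
    next
      case False
      obtain B where B: "set_mset B \<subseteq> E" "size B = n" "set_mono (range x) = mset_mono B + single (x 0) 1"
        using cycle_eq_edges_plus_vertex by blast
      have "m = mset_mono (replicate_mset j (range x)) + mset_mono (A + B) + single (x 0) 1"
        using Suc.prems(3) by (simp add: m' B(3) ac_simps)
      then show ?thesis using Suc.IH[of "A + B" "single (x 0) 1"] Suc.prems B False by simp
    qed
  qed
qed

section \<open>Degrees and unique factorization into edges\<close>

lemma degree_mset_mono:
  assumes "set_mset A \<subseteq> E"
  shows "wdeg UNIV (mset_mono A) = 2 * size A"
  using assms by (induction A) (auto simp: wdeg_set_mono card_edge)

lemma degree_cycle_power: "wdeg UNIV (mset_mono (replicate_mset j (range x))) = j * (2 * n + 1)"
  by (induction j) (auto simp: wdeg_set_mono card_range_x)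

lemma edge_otherE:
  assumes "e \<in> E" "v \<in> e"
  obtains w where "e = {v, w}" "{v, w} \<in> E"
proof -
  obtain a b where "e = {a, b}" using card_edge[OF assms(1)] by (auto simp: card_2_iff)
  then show thesis using assms that[of a] that[of b] by (auto simp: insert_commute)
qed

text \<open>The difference \<open>d\<close> of the multiplicities sums to 0 at every vertex. At a
  leaf this kills the pendant edge, so on the cycle consecutive values are opposite. One turn makes
  an odd number of sign changes, which forces \<open>D i = - D i\<close>.\<close>

lemma inj_on_mset_mono: "inj_on mset_mono {A. set_mset A \<subseteq> E}"
proof (rule inj_onI)
  fix A B assume AB: "A \<in> {A. set_mset A \<subseteq> E}" "B \<in> {A. set_mset A \<subseteq> E}" "mset_mono A = mset_mono B"
  define d where "d e = int (count A e) - int (count B e)" for e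
  have d0: "d e = 0" if "e \<notin> E" for e
  proof -
    have "e \<notin># A" "e \<notin># B" using AB(1,2) that by auto
    then show ?thesis by (simp add: d_def not_in_iff)
  qed
  have sum0: "(\<Sum>e\<in>{e\<in>E. v \<in> e}. d e) = 0" for v
  proof -
    have "int (lookup (mset_mono A) v) - int (lookup (mset_mono B) v) = (\<Sum>e\<in>E. if v \<in> e then d e else 0)"
      using AB(1,2) by (simp add: lookup_mset_mono[of _ E] d_def flip: sum_subtractf) (intro sum.cong, auto simp: d_def)
    then show ?thesis using AB(3) by (simp add: sum.inter_filter)
  qed
  have leaf: "d {y, u} = 0" if "y \<notin> range x" for y u
  proof (cases "{y, u} \<in> E")
    case True
    have "{e\<in>E. y \<in> e} = {{y, u}}"
    proof (intro equalityI subsetI)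
      fix e assume "e \<in> {e\<in>E. y \<in> e}"
      then obtain w where "e = {y, w}" "{y, w} \<in> E"
        using edge_otherE by blast
      then show "e \<in> {{y, u}}" using leaf_unique[OF that True] by auto
    qed (use True in auto)
    then show ?thesis using sum0[of y] by simp
  qed (rule d0)
  define D where "D i = d {x i, x (Suc i)}" for i
  have D: "D (Suc i) = - D i" for i
  proof -
    have "(\<Sum>e\<in>{e\<in>E. x (Suc i) \<in> e}. d e) = (\<Sum>e\<in>{{x i, x (Suc i)}, {x (Suc i), x (Suc (Suc i))}}. d e)"
    proof (rule sum.mono_neutral_right)
      show "\<forall>e\<in>{e\<in>E. x (Suc i) \<in> e} - {{x i, x (Suc i)}, {x (Suc i), x (Suc (Suc i))}}. d e = 0"
      proof
        fix e assume e: "e \<in> {e\<in>E. x (Suc i) \<in> e} - {{x i, x (Suc i)}, {x (Suc i), x (Suc (Suc i))}}"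
        then obtain w where w: "e = {x (Suc i), w}" "{x (Suc i), w} \<in> E"
          using edge_otherE[of e "x (Suc i)"] by blast
        then have "w \<notin> range x" using edge_at_cycle[OF w(2)] e by (auto simp: insert_commute)
        then show "d e = 0" using leaf[of w "x (Suc i)"] w by (simp add: insert_commute)
      qed
    qed (use cycle_edge in auto)
    moreover have "{x i, x (Suc i)} \<noteq> {x (Suc i), x (Suc (Suc i))}"
      using x_add2_neq[of i] x_Suc_neq[of i] by (auto simp: doubleton_eq_iff)
    ultimately show ?thesis using sum0[of "x (Suc i)"] by (simp add: D_def)
  qed
  have "D (i + t) = (-1) ^ t * D i" for i t
    by (induction t) (auto simp: D)
  from this[of _ "2 * n + 1"] have "D (i + (2 * n + 1)) = - D i" for i by simp
  moreover have "D (i + (2 * n + 1)) = D i" for i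
    using x_periodic[of i] x_periodic[of "Suc i"] by (simp add: D_def)
  ultimately have "D i = 0" for i by (metis neg_equal_zero)
  then have "d e = 0" for e
    using edge_cases[of e] d0[of e] leaf by (cases "e \<in> E") (auto simp: D_def)
  then show "A = B" by (intro multiset_eqI) (simp add: d_def)
qed

end

section \<open>Leading terms\<close>

text \<open>Exponent vectors indexed by natural numbers carry a linear order compatible with
  addition, but the vertex type has no order. Transport along this embedding provides a monomial
  order.\<close>

lemma ex_additive_order_embedding:
  "\<exists>\<phi> :: ('v::finite \<Rightarrow>\<^sub>0 nat) \<Rightarrow> (nat \<Rightarrow>\<^sub>0 nat). inj \<phi> \<and> (\<forall>a b. \<phi> (a + b) = \<phi> a + \<phi> b)"
proof -
  obtain f :: "'v \<Rightarrow> nat" where f: "inj f"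
    using finite_imp_inj_to_nat_seg[of "UNIV :: 'v set"] by auto
  define \<phi> :: "('v \<Rightarrow>\<^sub>0 nat) \<Rightarrow> (nat \<Rightarrow>\<^sub>0 nat)" where "\<phi> m = (\<Sum>v\<in>UNIV. single (f v) (lookup m v))" for m
  have "lookup (\<phi> m) (f v) = lookup m v" for m v
    by (simp add: \<phi>_def lookup_sum lookup_single when_def inj_eq[OF f])
  then have "inj \<phi>" by (intro injI poly_mapping_eqI) metis
  moreover have "\<phi> (a + b) = \<phi> a + \<phi> b" for a b
    by (simp add: \<phi>_def lookup_add single_add sum.distrib)
  ultimately show ?thesis by blast
qed

text \<open>Among the terms of \<open>f\<close> of least \<open>\<delta>\<close> take the largest one in a monomial order, and likewise
  for \<open>g\<close>; their product cannot cancel.\<close>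

lemma keys_mult_min_weight:
  fixes f g :: "('v::finite, 'k::field) mpoly" and \<delta> :: "('v \<Rightarrow>\<^sub>0 nat) \<Rightarrow> nat"
  assumes add: "\<And>a b. \<delta> (a + b) = \<delta> a + \<delta> b"
    and a: "a \<in> keys f" "\<And>a'. a' \<in> keys f \<Longrightarrow> \<delta> a \<le> \<delta> a'"
    and b: "b \<in> keys g" "\<And>b'. b' \<in> keys g \<Longrightarrow> \<delta> b \<le> \<delta> b'"
  shows "\<exists>c\<in>keys (f * g). \<delta> c = \<delta> a + \<delta> b"
proof -
  obtain \<phi> :: "('v \<Rightarrow>\<^sub>0 nat) \<Rightarrow> (nat \<Rightarrow>\<^sub>0 nat)"
    where \<phi>: "inj \<phi>" "\<And>a b. \<phi> (a + b) = \<phi> a + \<phi> b"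
    using ex_additive_order_embedding by metis
  have ex: "\<exists>c\<in>keys h. \<delta> c = d \<and> (\<forall>c'\<in>keys h. \<delta> c' = d \<longrightarrow> \<phi> c' \<le> \<phi> c)"
    if "c0 \<in> keys h" "\<delta> c0 = d" for h :: "('v, 'k) mpoly" and c0 d
  proof -
    have "Max (\<phi> ` {c\<in>keys h. \<delta> c = d}) \<in> \<phi> ` {c\<in>keys h. \<delta> c = d}"
      using that by (intro Max_in) auto
    then obtain c where "c \<in> keys h" "\<delta> c = d" "\<phi> c = Max (\<phi> ` {c\<in>keys h. \<delta> c = d})" by auto
    then show ?thesis by (intro bexI[of _ c]) auto
  qed
  obtain p where p: "p \<in> keys f" "\<delta> p = \<delta> a" "\<And>c. c \<in> keys f \<Longrightarrow> \<delta> c = \<delta> a \<Longrightarrow> \<phi> c \<le> \<phi> p"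
    using ex[OF a(1) refl] by blast
  obtain q where q: "q \<in> keys g" "\<delta> q = \<delta> b" "\<And>c. c \<in> keys g \<Longrightarrow> \<delta> c = \<delta> b \<Longrightarrow> \<phi> c \<le> \<phi> q"
    using ex[OF b(1) refl] by blast
  have uniq: "l = p \<and> r = q" if "l \<in> keys f" "r \<in> keys g" "p + q = l + r" for l r
  proof -
    have "\<delta> l + \<delta> r = \<delta> a + \<delta> b" using that(3) add p(2) q(2) by metis
    then have "\<delta> l = \<delta> a" "\<delta> r = \<delta> b" using a(2)[OF that(1)] b(2)[OF that(2)] by auto
    then have le: "\<phi> l \<le> \<phi> p" "\<phi> r \<le> \<phi> q" using p(3) q(3) that by auto
    have "\<phi> l + \<phi> r = \<phi> p + \<phi> q" using that(3) \<phi>(2) by metis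
    then have "\<phi> l = \<phi> p"
      using le by (metis add_less_le_mono order_le_less less_irrefl)
    then have "l = p" using \<phi>(1) by (simp add: inj_eq)
    then show ?thesis using that(3) by simp
  qed
  have "lookup (f * g) (p + q) = (\<Sum>(l, r). lookup f l * lookup g r when p + q = l + r)"
    by (simp add: times_poly_mapping.rep_eq prod_fun_unfold_prod)
  also have "\<dots> = (\<Sum>(l, r). lookup f l * lookup g r when (p, q) = (l, r))"
  proof (rule Sum_any.cong, clarify)
    fix l r
    show "(lookup f l * lookup g r when p + q = l + r) = (lookup f l * lookup g r when (p, q) = (l, r))"
      using uniq[of l r] by (cases "lookup f l = 0 \<or> lookup g r = 0") (auto simp: when_def in_keys_iff)
  qed
  also have "\<dots> = (\<Sum>z. (case z of (l, r) \<Rightarrow> lookup f l * lookup g r) when (p, q) = z)"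
    by (intro Sum_any.cong) auto
  also have "\<dots> = lookup f p * lookup g q"
    by (subst Sum_any_when_equal') simp
  finally have "p + q \<in> keys (f * g)"
    using p(1) q(1) by (simp add: in_keys_iff)
  then show ?thesis using add p(2) q(2) by (intro bexI[of _ "p + q"]) auto
qed

section \<open>Ideals\<close>

lemma ideal_class_ringI:
  fixes J :: "'a::comm_ring_1 set"
  assumes "0 \<in> J" "\<And>a b. a \<in> J \<Longrightarrow> b \<in> J \<Longrightarrow> a + b \<in> J" "\<And>a r. a \<in> J \<Longrightarrow> r * a \<in> J"
  shows "ideal J class_ring"
proof (rule idealI)
  show "ring (class_ring :: 'a ring)" by (rule class_ring.ring_axioms)
  have neg: "- a \<in> J" if "a \<in> J" for a using assms(3)[OF that, of "-1"] by simp
  have inv: "m_inv (add_monoid (class_ring :: 'a ring)) a = - a" for a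
    by (subst a_inv_def[symmetric]) (simp only: class_ring_simps)
  show "subgroup J (add_monoid class_ring)"
    using assms neg by unfold_locales (auto simp: inv[simplified])
  show "a \<otimes>\<^bsub>class_ring\<^esub> b \<in> J" if "a \<in> J" for a b
    using assms(3)[OF that, of b] by (simp add: mult.commute)
qed (use assms in auto)

lemma ideal_class_ringD:
  fixes J :: "'a::comm_ring_1 set"
  assumes "ideal J class_ring"
  shows "0 \<in> J" and "a \<in> J \<Longrightarrow> b \<in> J \<Longrightarrow> a + b \<in> J" and "a \<in> J \<Longrightarrow> r * a \<in> J"
    and "a \<in> J \<Longrightarrow> b \<in> J \<Longrightarrow> a - b \<in> J"
proof -
  interpret ideal J class_ring by fact
  show "0 \<in> J" using zero_closed by simp
  show add: "a + b \<in> J" if "a \<in> J" "b \<in> J" for a b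
    using additive_subgroup.a_closed[OF additive_subgroup_axioms that] by simp
  show mul: "r * a \<in> J" if "a \<in> J" for a r using I_l_closed[OF that, of r] by simp
  show "a \<in> J \<Longrightarrow> b \<in> J \<Longrightarrow> a - b \<in> J"
    using add[of a "- b"] mul[of b "-1"] by simp
qed

lemma ideal_sum_mem:
  assumes "ideal J (class_ring :: 'a::comm_ring_1 ring)" "\<And>i. i \<in> A \<Longrightarrow> f i \<in> J"
  shows "(\<Sum>i\<in>A. f i) \<in> J"
  using assms(2) by (induction A rule: infinite_finite_induct)
    (auto intro: ideal_class_ringD[OF assms(1)])

lemma mpoly_eq_sum: "(f :: ('v, 'k::field) mpoly) = (\<Sum>m\<in>keys f. single m (lookup f m))"
  by (rule poly_mapping_eqI) (simp add: lookup_sum lookup_single when_def in_keys_iff)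

lemma ideal_mem_if_keys:
  assumes J: "ideal J class_ring" and "\<And>m. m \<in> keys f \<Longrightarrow> single m 1 \<in> J"
  shows "(f :: ('v, 'k::field) mpoly) \<in> J"
proof -
  have "single m (lookup f m) \<in> J" if "m \<in> keys f" for m
    using ideal_class_ringD(3)[OF J assms(2)[OF that], of "single 0 (lookup f m)"]
    by (simp add: mult_single)
  then show ?thesis by (subst mpoly_eq_sum) (rule ideal_sum_mem[OF J])
qed

lemma ideal_monomial_span:
  fixes P :: "('v \<Rightarrow>\<^sub>0 nat) \<Rightarrow> bool"
  assumes "\<And>a b. P a \<Longrightarrow> P (a + b)"
  shows "ideal {f :: ('v, 'k::field) mpoly. \<forall>m\<in>keys f. P m} class_ring"
proof (rule ideal_class_ringI)
  fix a r :: "('v, 'k) mpoly" assume "a \<in> {f. \<forall>m\<in>keys f. P m}"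
  then show "r * a \<in> {f. \<forall>m\<in>keys f. P m}"
    using keys_mult[of a r] assms by (fastforce simp: mult.commute)
qed (use keys_add in fastforce)+

lemma ideal_power_0 [simp]: "ideal_power (J :: 'a::comm_ring_1 set) 0 = UNIV"
  by (simp add: ideal_power_def ideals_set_def nat_pow_def)

lemma ideal_power_Suc:
  "ideal_power (J :: 'a::comm_ring_1 set) (Suc s) = ideal_prod class_ring (ideal_power J s) J"
  by (simp add: ideal_power_def ideals_set_def nat_pow_def)

lemma ideal_ideal_power:
  assumes "ideal (J :: 'a::comm_ring_1 set) class_ring"
  shows "ideal (ideal_power J s) class_ring"
proof (induction s)
  case 0
  then show ?case using ring.oneideal[OF class_ring.ring_axioms] by simp
next
  case (Suc s)
  then show ?case unfolding ideal_power_Suc by (rule ring.ideal_prod_is_ideal[OF class_ring.ring_axioms _ assms])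
qed

definition edge_product_divides :: "'v::finite set set \<Rightarrow> nat \<Rightarrow> ('v \<Rightarrow>\<^sub>0 nat) \<Rightarrow> bool" where
  "edge_product_divides E s m \<longleftrightarrow> (\<exists>A m'. set_mset A \<subseteq> E \<and> size A = s \<and> m = mset_mono A + m')"

lemma edge_product_divides_add:
  "edge_product_divides E s m \<Longrightarrow> edge_product_divides E s (m + m')"
  unfolding edge_product_divides_def by (metis add.assoc)

lemma edge_product_divides_mult:
  assumes "edge_product_divides E s m" "edge_product_divides E t m'"
  shows "edge_product_divides E (s + t) (m + m')"
proof -
  obtain A p B q where "set_mset A \<subseteq> E" "size A = s" "m = mset_mono A + p"
    "set_mset B \<subseteq> E" "size B = t" "m' = mset_mono B + q"
    using assms unfolding edge_product_divides_def by blast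
  then show ?thesis unfolding edge_product_divides_def
    by (intro exI[of _ "A + B"] exI[of _ "p + q"]) (auto simp: ac_simps)
qed

lemma ideal_edge_ideal: "ideal (edge_ideal E :: ('v::finite, 'k::field) mpoly set) class_ring"
  unfolding edge_ideal_def by (rule ring.genideal_ideal[OF class_ring.ring_axioms]) simp

lemma edge_mono_mem_edge_ideal:
  assumes "e \<in> E" "card e = 2"
  shows "(single (set_mono e) 1 :: ('v::finite, 'k::field) mpoly) \<in> edge_ideal E"
proof -
  obtain u v where uv: "e = {u, v}" "u \<noteq> v" using assms(2) by (auto simp: card_2_iff)
  then have "single (set_mono e) 1 = (var u * var v :: ('v, 'k) mpoly)"
    by (simp add: var_def mult_single set_mono_def)
  moreover have "(var u * var v :: ('v, 'k) mpoly) \<in> edge_ideal E"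
    unfolding edge_ideal_def by (rule subsetD[OF ring.genideal_self[OF class_ring.ring_axioms]]) (use assms uv in auto)
  ultimately show ?thesis by simp
qed

lemma edge_ideal_subset:
  assumes "simple_graph E"
  shows "(edge_ideal E :: ('v::finite, 'k::field) mpoly set) \<subseteq> {f. \<forall>m\<in>keys f. edge_product_divides E 1 m}"
  unfolding edge_ideal_def
proof (rule ring.genideal_minimal[OF class_ring.ring_axioms])
  show "ideal {f :: ('v, 'k) mpoly. \<forall>m\<in>keys f. edge_product_divides E 1 m} class_ring"
    by (rule ideal_monomial_span) (rule edge_product_divides_add)
  show "{var u * var v :: ('v, 'k) mpoly | u v. {u, v} \<in> E} \<subseteq> {f. \<forall>m\<in>keys f. edge_product_divides E 1 m}"
  proof clarify
    fix u v :: 'v and m assume uv: "{u, v} \<in> E" "m \<in> keys (var u * var v :: ('v, 'k) mpoly)"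
    then have "u \<noteq> v" using assms by (auto simp: simple_graph_def)
    then have "m = set_mono {u, v}" using uv(2) by (simp add: var_def mult_single set_mono_def)
    then show "edge_product_divides E 1 m"
      unfolding edge_product_divides_def using uv(1) by (intro exI[of _ "{#{u, v}#}"] exI[of _ 0]) auto
  qed
qed

text \<open>Powers of a monomial ideal are monomial, so membership is a condition on each exponent
  vector separately. All later arguments about the ordinary power work with exponents.\<close>

lemma ideal_power_edge_ideal:
  assumes "simple_graph E"
  shows "(ideal_power (edge_ideal E) s :: ('v::finite, 'k::field) mpoly set)
    = {f. \<forall>m\<in>keys f. edge_product_divides E s m}" (is "?L s = ?R s")
proof (intro equalityI subsetI)
  fix f :: "('v, 'k) mpoly" assume "f \<in> ?L s"
  then show "f \<in> ?R s"
  proof (induction s arbitrary: f)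
    case 0
    then show ?case unfolding edge_product_divides_def by auto
  next
    case (Suc s)
    have id: "ideal (?R (Suc s)) class_ring"
      by (rule ideal_monomial_span) (rule edge_product_divides_add)
    from Suc.prems show ?case unfolding ideal_power_Suc
    proof (induction rule: ideal_prod.induct)
      case (prod a b)
      have "edge_product_divides E (Suc s) m" if mem: "m \<in> keys (a * b)" for m
      proof -
        obtain p q where pq: "p \<in> keys a" "q \<in> keys b" "m = p + q"
          using subsetD[OF keys_mult mem] by blast
        have "edge_product_divides E s p" using Suc.IH[OF prod(1)] pq(1) by blast
        moreover have "edge_product_divides E 1 q"
          using subsetD[OF edge_ideal_subset[OF assms] prod(2)] pq(2) by blast
        ultimately show ?thesis using edge_product_divides_mult pq(3) by fastforce
      qed
      then have "a * b \<in> ?R (Suc s)" by blast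
      then show ?case by (simp only: ring_record_simps)
    next
      case (sum a b)
      have "a + b \<in> ?R (Suc s)" by (rule ideal_class_ringD(2)[OF id sum.IH])
      then show ?case by (simp only: ring_record_simps)
    qed
  qed
next
  fix f :: "('v, 'k) mpoly" assume f: "f \<in> ?R s"
  have mem: "(single (mset_mono A) 1 :: ('v, 'k) mpoly) \<in> ideal_power (edge_ideal E) (size A)"
    if "set_mset A \<subseteq> E" for A
    using that
  proof (induction A)
    case (add e A)
    then have "e \<in> E" "card e = 2" using assms by (auto simp: simple_graph_def)
    then have "single (mset_mono A) 1 * single (set_mono e) (1::'k)
        \<in> ideal_prod class_ring (ideal_power (edge_ideal E) (size A)) (edge_ideal E)"
      using ideal_prod.prod[of _ _ _ _ class_ring] add edge_mono_mem_edge_ideal by fastforce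
    then show ?case by (simp add: ideal_power_Suc mult_single add.commute)
  qed simp
  have id: "ideal (?L s) class_ring" by (rule ideal_ideal_power[OF ideal_edge_ideal])
  show "f \<in> ?L s"
  proof (rule ideal_mem_if_keys[OF id])
    fix m assume "m \<in> keys f"
    then obtain A m' where "set_mset A \<subseteq> E" "size A = s" "m = mset_mono A + m'"
      using f unfolding edge_product_divides_def by blast
    then show "single m (1::'k) \<in> ?L s"
      using ideal_class_ringD(3)[OF id, of "single (mset_mono A) 1" "single m' 1"] mem[of A]
      by (simp add: mult_single add.commute)
  qed
qed

section \<open>Symbolic powers\<close>

lemma primeideal_class_ringD:
  assumes "primeideal (p :: 'a::comm_ring_1 set) class_ring"
  shows "ideal p class_ring" "1 \<notin> p" "a \<notin> p \<Longrightarrow> b \<notin> p \<Longrightarrow> a * b \<notin> p"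
proof -
  interpret primeideal p class_ring by fact
  show id: "ideal p class_ring" by (rule ideal_axioms)
  show "a \<notin> p \<Longrightarrow> b \<notin> p \<Longrightarrow> a * b \<notin> p" using I_prime[of a b] by auto
  show "1 \<notin> p" using ideal_class_ringD(3)[OF id, of 1] I_notcarr by auto
qed

text \<open>Clearing denominators removes fractions from the rest of the proof. From f/1 = a/u,
  witnessed by t, the multiplier is \<open>t * u\<close>, outside \<open>p\<close> by primality;
  conversely f/1 equals (w f)/w.\<close>

lemma mem_local_contraction_iff:
  fixes p J :: "'a::comm_ring_1 set"
  assumes "primeideal p class_ring" "ideal J class_ring"
  shows "f \<in> local_contraction p (local_extension p J) \<longleftrightarrow> (\<exists>w. w \<notin> p \<and> w * f \<in> J)"
proof
  note p = primeideal_class_ringD[OF assms(1)]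
  assume "f \<in> local_contraction p (local_extension p J)"
  then obtain a u where au: "a \<in> J" "u \<notin> p" "local_frac p f 1 = local_frac p a u"
    unfolding local_contraction_def local_extension_def by blast
  have "(a, u) \<in> local_frac p a u"
    using au(2) p(2) unfolding local_frac_def by (auto intro: exI[of _ 1])
  then have "(a, u) \<in> local_frac p f 1" using au(3) by simp
  then obtain t where t: "t \<notin> p" "t * (f * u - a * 1) = 0" unfolding local_frac_def by auto
  then have "t * u * f = t * a" by (simp add: algebra_simps)
  then show "\<exists>w. w \<notin> p \<and> w * f \<in> J"
    using ideal_class_ringD(3)[OF assms(2) au(1), of t] p(3)[OF t(1) au(2)] by metis
next
  note p = primeideal_class_ringD[OF assms(1)]
  assume "\<exists>w. w \<notin> p \<and> w * f \<in> J"
  then obtain w where w: "w \<notin> p" "w * f \<in> J" by blast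
  have "local_frac p f 1 = local_frac p (w * f) w"
    unfolding local_frac_def
  proof (intro Collect_cong prod.case_cong conj_cong refl iffI)
    fix b v
    assume "\<exists>t. t \<notin> p \<and> t * (f * v - b * 1) = 0"
    then obtain t where t: "t \<notin> p" "t * (f * v - b * 1) = 0" by blast
    have "t * (w * f * v - b * w) = w * (t * (f * v - b * 1))" by (simp add: algebra_simps)
    then show "\<exists>t. t \<notin> p \<and> t * (w * f * v - b * w) = 0" using t by auto
  next
    fix b v
    assume "\<exists>t. t \<notin> p \<and> t * (w * f * v - b * w) = 0"
    then obtain t where t: "t \<notin> p" "t * (w * f * v - b * w) = 0" by blast
    have "t * w * (f * v - b * 1) = t * (w * f * v - b * w)" by (simp add: algebra_simps)
    then show "\<exists>t. t \<notin> p \<and> t * (f * v - b * 1) = 0" using t w p(3) by metis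
  qed
  then show "f \<in> local_contraction p (local_extension p J)"
    unfolding local_contraction_def local_extension_def using w by blast
qed

lemma associated_prime_primeideal: "p \<in> associated_primes J \<Longrightarrow> primeideal p class_ring"
  by (simp add: associated_primes_def)

lemma mem_symbolic_power_iff:
  fixes J :: "'a::comm_ring_1 set"
  assumes "ideal J class_ring"
  shows "f \<in> symbolic_power J s \<longleftrightarrow>
    (\<forall>p\<in>associated_primes J. \<exists>w. w \<notin> p \<and> w * f \<in> ideal_power J s)"
  unfolding symbolic_power_def INT_iff
  using mem_local_contraction_iff[OF associated_prime_primeideal ideal_ideal_power[OF assms]]
  by (metis (no_types, lifting))

lemma ideal_symbolic_power:
  fixes J :: "'a::comm_ring_1 set"
  assumes "ideal J class_ring"
  shows "ideal (symbolic_power J s) class_ring"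
proof (rule ideal_class_ringI)
  note pow = ideal_class_ringD[OF ideal_ideal_power[OF assms, of s]]
  show "0 \<in> symbolic_power J s"
    unfolding mem_symbolic_power_iff[OF assms]
    using pow(1) primeideal_class_ringD(2) associated_prime_primeideal by (metis mult_zero_right)
  fix a b assume ab: "a \<in> symbolic_power J s" "b \<in> symbolic_power J s"
  show "a + b \<in> symbolic_power J s"
    unfolding mem_symbolic_power_iff[OF assms]
  proof
    fix p assume p: "p \<in> associated_primes J"
    obtain w w' where w: "w \<notin> p" "w * a \<in> ideal_power J s" "w' \<notin> p" "w' * b \<in> ideal_power J s"
      using ab p unfolding mem_symbolic_power_iff[OF assms] by blast
    have "w' * (w * a) + w * (w' * b) \<in> ideal_power J s" using pow(2,3) w by blast
    also have "w' * (w * a) + w * (w' * b) = w * w' * (a + b)" by (simp add: algebra_simps)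
    finally show "\<exists>w. w \<notin> p \<and> w * (a + b) \<in> ideal_power J s"
      using primeideal_class_ringD(3)[OF associated_prime_primeideal[OF p]] w by blast
  qed
next
  note pow = ideal_class_ringD[OF ideal_ideal_power[OF assms, of s]]
  fix a r assume "a \<in> symbolic_power J s"
  then show "r * a \<in> symbolic_power J s"
    unfolding mem_symbolic_power_iff[OF assms] using pow(3) by (metis mult.left_commute)
qed

section \<open>Associated primes of the edge ideal and the weight bound\<close>

lemma edge_product_divides_1_iff:
  "edge_product_divides E 1 m \<longleftrightarrow> (\<exists>e\<in>E. \<forall>v\<in>e. 0 < lookup m v)"
proof
  assume "edge_product_divides E 1 m"
  then obtain A m' where A: "set_mset A \<subseteq> E" "size A = 1" "m = mset_mono A + m'"
    unfolding edge_product_divides_def by blast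
  then obtain e where "A = {#e#}" by (metis size_1_singleton_mset)
  then show "\<exists>e\<in>E. \<forall>v\<in>e. 0 < lookup m v" using A by (auto simp: lookup_add lookup_set_mono)
next
  assume "\<exists>e\<in>E. \<forall>v\<in>e. 0 < lookup m v"
  then obtain e where e: "e \<in> E" "\<And>v. v \<in> e \<Longrightarrow> 0 < lookup m v" by blast
  then obtain m' where "m = set_mono e + m'" using set_mono_divides by metis
  then show "edge_product_divides E 1 m"
    unfolding edge_product_divides_def using e by (intro exI[of _ "{#e#}"] exI[of _ m']) auto
qed

lemma edge_ideal_eq:
  assumes "simple_graph E"
  shows "(edge_ideal E :: ('v::finite, 'k::field) mpoly set) = {f. \<forall>m\<in>keys f. edge_product_divides E 1 m}"
proof (intro equalityI edge_ideal_subset[OF assms] subsetI)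
  fix f :: "('v, 'k) mpoly" assume f: "f \<in> {f. \<forall>m\<in>keys f. edge_product_divides E 1 m}"
  show "f \<in> edge_ideal E"
  proof (rule ideal_mem_if_keys[OF ideal_edge_ideal])
    fix m assume "m \<in> keys f"
    then obtain e where e: "e \<in> E" "\<And>v. v \<in> e \<Longrightarrow> 0 < lookup m v"
      using f unfolding edge_product_divides_1_iff by blast
    then obtain m' where "m = set_mono e + m'" using set_mono_divides by metis
    then have "(single m 1 :: ('v, 'k) mpoly) = single m' 1 * single (set_mono e) 1"
      by (simp add: mult_single add.commute)
    then show "(single m 1 :: ('v, 'k) mpoly) \<in> edge_ideal E"
      using ideal_class_ringD(3)[OF ideal_edge_ideal edge_mono_mem_edge_ideal[OF e(1)]]
        assms e(1) by (simp add: simple_graph_def)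
  qed
qed

text \<open>The edge ideal is radical and contains no variable, so the irrelevant ideal is not associated.\<close>

lemma associated_prime_edge_ideal_omits_var:
  assumes "simple_graph E" and p: "p \<in> associated_primes (edge_ideal E)"
  obtains v where "(var v :: ('v::finite, 'k::field) mpoly) \<notin> p"
proof -
  obtain f :: "('v, 'k) mpoly" where f: "p = {g. g * f \<in> edge_ideal E}"
    using p unfolding associated_primes_def by blast
  have "1 \<notin> p" by (rule primeideal_class_ringD(2)[OF associated_prime_primeideal[OF p]])
  then obtain m where m: "m \<in> keys f" "\<not> edge_product_divides E 1 m"
    unfolding f edge_ideal_eq[OF assms(1)] by auto
  \<comment> \<open>Multiplying the term \<open>m\<close> by a variable it already contains does not
    change its support, so the product still contains no edge. If \<open>m = 0\<close>, the product
    is a single variable and any \<open>v\<close> will do.\<close>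
  obtain v where v: "0 < lookup m v \<or> m = 0"
    by (metis gr0I lookup_zero poly_mapping_eqI)
  have "var v \<notin> p"
  proof
    assume "var v \<in> p"
    moreover have "single v 1 + m \<in> keys (var v * f)"
    proof -
      have "lookup (var v * f) (single v 1 + m) = lookup f m"
        unfolding lookup_mult var_def
        by (simp add: lookup_single when_mult)
      then show ?thesis using m by (simp add: in_keys_iff)
    qed
    ultimately have "edge_product_divides E 1 (single v 1 + m)"
      unfolding f edge_ideal_eq[OF assms(1)] by blast
    then obtain e where e: "e \<in> E" "\<And>u. u \<in> e \<Longrightarrow> 0 < lookup (single v 1 + m) u"
      unfolding edge_product_divides_1_iff by blast
    from v show False
    proof
      assume "0 < lookup m v"
      then have "0 < lookup m u" if "u \<in> e" for u
        using e(2)[OF that] by (auto simp: lookup_add lookup_single when_def split: if_splits)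
      then show False using m(2) e(1) unfolding edge_product_divides_1_iff by blast
    next
      assume "m = 0"
      then have "u = v" if "u \<in> e" for u
        using e(2)[OF that] by (auto simp: lookup_single when_def split: if_splits)
      then have "e \<subseteq> {v}" by blast
      then have "card e \<le> 1" using card_mono[of "{v}" e] by simp
      then show False using assms(1) e(1) by (auto simp: simple_graph_def)
    qed
  qed
  then show thesis by (rule that)
qed

text \<open>The ideal generated by the variables of \<open>W\<close>, described through its
  terms.\<close>

definition cover_prime :: "'v::finite set \<Rightarrow> ('v, 'k::field) mpoly set" where
  "cover_prime W = {f. \<forall>m\<in>keys f. 0 < wdeg W m}"

lemma ex_key_min_weight:
  assumes "m \<in> keys f"
  shows "\<exists>a\<in>keys f. \<forall>a'\<in>keys f. wdeg W a \<le> wdeg W a'"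
  using assms ex_min_if_finite[of "wdeg W ` keys f"] by (fastforce simp: not_less)

lemma primeideal_cover_prime: "primeideal (cover_prime W :: ('v::finite, 'k::field) mpoly set) class_ring"
proof (rule primeidealI)
  show "ideal (cover_prime W :: ('v, 'k) mpoly set) class_ring"
    unfolding cover_prime_def by (rule ideal_monomial_span) simp
  show "cring (class_ring :: ('v, 'k) mpoly ring)" by (rule class_cring.cring_axioms)
  have "(1 :: ('v, 'k) mpoly) \<notin> cover_prime W" by (simp add: cover_prime_def)
  then show "carrier (class_ring :: ('v, 'k) mpoly ring) \<noteq> cover_prime W" by auto
  fix a b :: "('v, 'k) mpoly"
  assume "a \<otimes>\<^bsub>class_ring\<^esub> b \<in> cover_prime W"
  then have ab: "a * b \<in> cover_prime W" by (simp only: ring_record_simps)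
  show "a \<in> cover_prime W \<or> b \<in> cover_prime W"
  proof (rule ccontr)
    assume "\<not> ?thesis"
    then obtain p q where "p \<in> keys a" "wdeg W p = 0" "q \<in> keys b" "wdeg W q = 0"
      unfolding cover_prime_def by auto
    then have "\<exists>c\<in>keys (a * b). wdeg W c = 0"
      using keys_mult_min_weight[of "wdeg W" p a q b] by auto
    then show False using ab unfolding cover_prime_def by auto
  qed
qed

lemma lookup_times_single: "lookup (f * single a 1) (m + a) = lookup (f :: ('v::finite, 'k::field) mpoly) m"
proof -
  have "lookup (single a 1 * f) (a + m) = lookup f m"
    unfolding lookup_mult by (simp add: lookup_single when_mult)
  then show ?thesis by (simp add: mult.commute add.commute)
qed

text \<open>The prime is the annihilator of the product \<open>h\<close> of all variables outside
  \<open>W\<close>. By minimality each \<open>v\<close> in \<open>W\<close> has an edge meeting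
  \<open>W\<close> only in \<open>v\<close>, so its variable times \<open>h\<close> is in the edge
  ideal; as \<open>W\<close> is a cover, a monomial avoiding \<open>W\<close> never brings
  \<open>h\<close> into it.\<close>

lemma cover_prime_associated:
  assumes "simple_graph E" and W: "vertex_cover E W"
    and min: "\<And>W'. W' \<subset> W \<Longrightarrow> \<not> vertex_cover E W'"
  shows "(cover_prime W :: ('v::finite, 'k::field) mpoly set) \<in> associated_primes (edge_ideal E)"
proof -
  define h :: "('v, 'k) mpoly" where "h = single (set_mono (- W)) 1"
  have "g \<in> cover_prime W \<longleftrightarrow> g * h \<in> edge_ideal E" for g :: "('v, 'k) mpoly"
  proof
    assume g: "g \<in> cover_prime W"
    have "edge_product_divides E 1 m" if mem: "m \<in> keys (g * h)" for m
    proof -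
      obtain a where a: "a \<in> keys g" "m = a + set_mono (- W)"
        using subsetD[OF keys_mult mem] unfolding h_def by auto
      have "0 < wdeg W a" using g a(1) unfolding cover_prime_def by blast
      then obtain v where v: "v \<in> W" "0 < lookup a v"
        using wdeg_eq_0_iff[of W a] by (metis gr0I less_irrefl)
      then have "\<not> vertex_cover E (W - {v})" using min by blast
      then obtain e where e: "e \<in> E" "e \<inter> (W - {v}) = {}" unfolding vertex_cover_def by auto
      then have "0 < lookup m u" if "u \<in> e" for u
        using that v(2) unfolding a(2) lookup_add lookup_set_mono by (cases "u = v") auto
      then show ?thesis using e(1) unfolding edge_product_divides_1_iff by blast
    qed
    then show "g * h \<in> edge_ideal E" unfolding edge_ideal_eq[OF assms(1)] by blast
  next
    assume gh: "g * h \<in> edge_ideal E"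
    have "0 < wdeg W m" if "m \<in> keys g" for m
    proof -
      have "m + set_mono (- W) \<in> keys (g * h)"
        using that unfolding h_def in_keys_iff lookup_times_single .
      then have "edge_product_divides E 1 (m + set_mono (- W))"
        using gh unfolding edge_ideal_eq[OF assms(1)] by blast
      then obtain e where e: "e \<in> E" "\<And>v. v \<in> e \<Longrightarrow> 0 < lookup (m + set_mono (- W)) v"
        unfolding edge_product_divides_1_iff by blast
      then obtain v where "v \<in> e" "v \<in> W" using W unfolding vertex_cover_def by blast
      then have "0 < lookup m v" using e(2)[of v] by (simp add: lookup_add lookup_set_mono)
      then show ?thesis using \<open>v \<in> W\<close> wdeg_eq_0_iff[of W m] by (metis gr0I less_irrefl)
    qed
    then show "g \<in> cover_prime W" by (simp add: cover_prime_def)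
  qed
  then have "cover_prime W = {g. g * h \<in> edge_ideal E}" by blast
  then show ?thesis unfolding associated_primes_def using primeideal_cover_prime by blast
qed

text \<open>A multiplier outside the prime of a minimal cover \<open>U\<close> has a term of
  \<open>U\<close>-weight 0. The product with \<open>f\<close> therefore retains the least
  \<open>U\<close>-weight of \<open>f\<close>, and every term of the ordinary power has weight at
  least \<open>s\<close>. Enlarging \<open>U\<close> to \<open>W\<close> only adds weight.\<close>

lemma symbolic_power_weight:
  fixes f :: "('v::finite, 'k::field) mpoly"
  assumes "simple_graph E" and W: "vertex_cover E W"
    and f: "f \<in> symbolic_power (edge_ideal E) s" and m: "m \<in> keys f"
  shows "s \<le> wdeg W m"
proof -
  obtain U where U: "vertex_cover E U" "U \<subseteq> W" "\<And>W'. W' \<subset> U \<Longrightarrow> \<not> vertex_cover E W'"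
    using finite_has_minimal2[of "{U. vertex_cover E U}" W] W by (auto simp: psubset_eq)
  have "(cover_prime U :: ('v, 'k) mpoly set) \<in> associated_primes (edge_ideal E)"
    by (rule cover_prime_associated[OF assms(1) U(1,3)])
  then obtain g :: "('v, 'k) mpoly" where g: "g \<notin> cover_prime U" "g * f \<in> ideal_power (edge_ideal E) s"
    using f unfolding mem_symbolic_power_iff[OF ideal_edge_ideal] by blast
  obtain a where a: "a \<in> keys f" "\<And>a'. a' \<in> keys f \<Longrightarrow> wdeg U a \<le> wdeg U a'"
    using ex_key_min_weight[OF m] by blast
  obtain b where b: "b \<in> keys g" "wdeg U b = 0" using g(1) unfolding cover_prime_def by auto
  obtain c where c: "c \<in> keys (g * f)" "wdeg U c = wdeg U a"
    using keys_mult_min_weight[of "wdeg U" b g a f] a b by auto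
  obtain A m' where "set_mset A \<subseteq> E" "size A = s" "c = mset_mono A + m'"
    using g(2) c(1) unfolding ideal_power_edge_ideal[OF assms(1)] edge_product_divides_def by blast
  then have "s \<le> wdeg U c" using wdeg_mset_mono_ge[of A E U] U(1) by simp
  also have "\<dots> \<le> wdeg U m" using c(2) a(2)[OF m] by simp
  also have "\<dots> \<le> wdeg W m" unfolding wdeg_def using U(2) by (intro sum_mono2) auto
  finally show ?thesis .
qed

lemma var_power: "var v ^ j = (single (mset_mono (replicate_mset j {v})) 1 :: ('v::finite, 'k::field) mpoly)"
  by (induction j) (auto simp: var_def mult_single set_mono_def)

lemma primeideal_power_notin:
  assumes "primeideal (p :: 'a::comm_ring_1 set) class_ring" "a \<notin> p"
  shows "a ^ j \<notin> p"
  using primeideal_class_ringD(2,3)[OF assms(1)] assms(2) by (induction j) auto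

context whiskered_odd_cycle
begin

lemma simple_graph_E: "simple_graph E"
  using card_edge by (simp add: simple_graph_def)

lemma cycle_power_times_var_power:
  "\<exists>B. set_mset B \<subseteq> E \<and> size B = j * (n + 1) \<and>
     mset_mono (replicate_mset j (range x)) + mset_mono (replicate_mset j {v}) = mset_mono B"
proof (induction j)
  case (Suc j)
  then obtain B where B: "set_mset B \<subseteq> E" "size B = j * (n + 1)"
    "mset_mono (replicate_mset j (range x)) + mset_mono (replicate_mset j {v}) = mset_mono B" by blast
  obtain A where A: "set_mset A \<subseteq> E" "size A = n + 1" "set_mono (range x) + single v 1 = mset_mono A"
    using cycle_plus_vertex by blast
  have "set_mono {v} = single v 1" by (simp add: set_mono_def)
  then have "mset_mono (replicate_mset (Suc j) (range x)) + mset_mono (replicate_mset (Suc j) {v})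
    = mset_mono (A + B)"
    using A(3) B(3) by (simp flip: A(3) B(3) add: ac_simps)
  then show ?case using A B by (intro exI[of _ "A + B"]) auto
qed simp

text \<open>Whatever the associated prime, it omits some variable \<open>v\<close>. Then
  \<open>var v ^ j\<close> is a valid multiplier, since each of the \<open>j\<close> cycles absorbs
  one \<open>v\<close> and becomes \<open>n + 1\<close> edges.\<close>

lemma monomial_mem_symbolic_power:
  assumes "set_mset A \<subseteq> E" "size A + j * (n + 1) = s"
  shows "(single (mset_mono (replicate_mset j (range x)) + mset_mono A) 1 :: ('v, 'k::field) mpoly)
    \<in> symbolic_power (edge_ideal E) s"
  unfolding mem_symbolic_power_iff[OF ideal_edge_ideal]
proof
  fix p :: "('v, 'k) mpoly set" assume p: "p \<in> associated_primes (edge_ideal E)"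
  obtain v where "var v \<notin> p" by (rule associated_prime_edge_ideal_omits_var[OF simple_graph_E p])
  then have v: "var v ^ j \<notin> p"
    by (rule primeideal_power_notin[OF associated_prime_primeideal[OF p]])
  obtain B where B: "set_mset B \<subseteq> E" "size B = j * (n + 1)"
    "mset_mono (replicate_mset j (range x)) + mset_mono (replicate_mset j {v}) = mset_mono B"
    using cycle_power_times_var_power by blast
  have "edge_product_divides E s (mset_mono (A + B))"
    unfolding edge_product_divides_def using B assms by (intro exI[of _ "A + B"] exI[of _ 0]) auto
  moreover have "var v ^ j * single (mset_mono (replicate_mset j (range x)) + mset_mono A) (1::'k)
    = single (mset_mono (A + B)) 1"
    by (simp add: var_power mult_single ac_simps flip: B(3))
  ultimately show "\<exists>w. w \<notin> p \<and> w * single (mset_mono (replicate_mset j (range x)) + mset_mono A) 1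
      \<in> ideal_power (edge_ideal E) s"
    using v unfolding ideal_power_edge_ideal[OF simple_graph_E] by (intro exI[of _ "var v ^ j"]) simp
qed

lemma symbolic_power_keys:
  assumes "f \<in> symbolic_power (edge_ideal E :: ('v, 'k::field) mpoly set) s" "m \<in> keys f"
  shows "edge_product_divides E s m \<or>
    (\<exists>j A. 1 \<le> j \<and> set_mset A \<subseteq> E \<and> size A + j * (n + 1) = s \<and>
       m = mset_mono (replicate_mset j (range x)) + mset_mono A)"
proof -
  have "s \<le> wdeg W m" if "vertex_cover E W" for W
    by (rule symbolic_power_weight[OF simple_graph_E that assms])
  then obtain j A m' where "set_mset A \<subseteq> E" "s \<le> size A + j * (n + 1)"
    "m = mset_mono (replicate_mset j (range x)) + mset_mono A + m'"
    using covers_imp_decomposition[of s m] by blast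
  from decomposition_cases[OF this] show ?thesis unfolding edge_product_divides_def .
qed

end

section \<open>Dimensions of the graded components\<close>

abbreviation coset :: "('v::finite, 'k::field) mpoly set \<Rightarrow> ('v, 'k) mpoly \<Rightarrow> ('v, 'k) mpoly set" where
  "coset I f \<equiv> I +>\<^bsub>class_ring\<^esub> f"

lemma coset_def': "coset I f = {i + f | i. i \<in> I}"
  unfolding a_r_coset_def' by auto

context
  fixes I :: "('v::finite, 'k::field) mpoly set"
  assumes I: "ideal I class_ring"
begin

lemma coset_eq_iff: "coset I f = coset I g \<longleftrightarrow> f - g \<in> I"
proof
  assume "coset I f = coset I g"
  moreover have "f \<in> coset I f"
    unfolding coset_def' using ideal_class_ringD(1)[OF I] by (auto intro: exI[of _ 0])
  ultimately obtain i where "i \<in> I" "f = i + g" unfolding coset_def' by auto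
  then show "f - g \<in> I" by simp
next
  assume fg: "f - g \<in> I"
  show "coset I f = coset I g"
    unfolding coset_def'
  proof (intro Collect_cong iffI)
    fix h assume "\<exists>i. h = i + f \<and> i \<in> I"
    then obtain i where "h = i + f" "i \<in> I" by blast
    then show "\<exists>i. h = i + g \<and> i \<in> I"
      using ideal_class_ringD(2)[OF I _ fg, of i] by (intro exI[of _ "i + (f - g)"]) auto
  next
    fix h assume "\<exists>i. h = i + g \<and> i \<in> I"
    then obtain i where "h = i + g" "i \<in> I" by blast
    then show "\<exists>i. h = i + f \<and> i \<in> I"
      using ideal_class_ringD(4)[OF I _ fg, of i] by (intro exI[of _ "i - (f - g)"]) auto
  qed
qed

lemma coset_zero: "coset I 0 = I"
  unfolding coset_def' by simp

lemma coset_add: "set_add class_ring (coset I f) (coset I g) = coset I (f + g)"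
proof -
  interpret ideal I class_ring by (rule I)
  show ?thesis using a_rcos_sum[of f g] by simp
qed

text \<open>The scalar action takes the union over all representatives of a class; they all yield
  the same coset.\<close>

lemma coset_smult: "(\<Union>a\<in>coset I f. coset I (const c * a)) = coset I (const c * f)"
proof -
  have "coset I (const c * a) = coset I (const c * f)" if mem: "a \<in> coset I f" for a
  proof -
    obtain i where "i \<in> I" "a = i + f" using mem unfolding coset_def' by blast
    then have "const c * a - const c * f = const c * i" by (simp add: algebra_simps)
    then show ?thesis unfolding coset_eq_iff using ideal_class_ringD(3)[OF I \<open>i \<in> I\<close>] by simp
  qed
  moreover have "f \<in> coset I f"
    unfolding coset_def' using ideal_class_ringD(1)[OF I] by (auto intro: exI[of _ 0])
  ultimately show ?thesis by blast
qed

end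

lemma homogeneous_iff: "homogeneous d f \<longleftrightarrow> (\<forall>m\<in>keys f. wdeg UNIV m = d)"
  by (simp add: homogeneous_def wdeg_def)

lemma keys_const_mult: "keys (const c * f) \<subseteq> keys f"
  using keys_mult[of "const c" f] by (auto simp: const_def split: if_splits)

lemma const_add: "const (a + b) = const a + const b"
  by (simp add: const_def single_add)

lemma const_times: "const (a * b) = const a * const b"
  by (simp add: const_def mult_single)

lemma const_one: "const 1 = 1"
  by (simp add: const_def)

lemma quotient_component_vectorspace:
  fixes I J :: "('v::finite, 'k::field) mpoly set"
  assumes I: "ideal I class_ring" and J: "ideal J class_ring"
  shows "vectorspace class_ring (quotient_component J I d)"
proof -
  let ?V = "quotient_component J I d"
  note Jd = ideal_class_ringD[OF J]
  have car: "carrier ?V = coset I ` {f \<in> J. homogeneous d f}"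
    by (auto simp: quotient_component_def)
  have addV: "coset I f \<oplus>\<^bsub>?V\<^esub> coset I g = coset I (f + g)" for f g
    by (simp add: quotient_component_def coset_add[OF I])
  have smV: "c \<odot>\<^bsub>?V\<^esub> coset I f = coset I (const c * f)" for c f
    using coset_smult[OF I] by (simp add: quotient_component_def)
  have zeroV: "\<zero>\<^bsub>?V\<^esub> = coset I 0"
    by (simp add: quotient_component_def coset_zero[OF I])
  have hom_add: "homogeneous d (f + g)" if "homogeneous d f" "homogeneous d g" for f g :: "('v, 'k) mpoly"
    using that keys_add[of f g] unfolding homogeneous_def by blast
  have hom_const: "homogeneous d (const c * f)" if "homogeneous d f" for c and f :: "('v, 'k) mpoly"
    using that keys_const_mult[of c f] unfolding homogeneous_def by blast
  have carI: "coset I f \<in> carrier ?V" if "f \<in> J" "homogeneous d f" for f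
    using that car by blast
  have carE: "\<exists>f\<in>J. homogeneous d f \<and> X = coset I f" if "X \<in> carrier ?V" for X
    using that car by blast
  have "module class_ring ?V"
  proof (rule moduleI)
    show "cring (class_ring :: 'k ring)" by (rule class_cring.cring_axioms)
    show "abelian_group ?V"
    proof (rule abelian_groupI)
      show "\<zero>\<^bsub>?V\<^esub> \<in> carrier ?V" unfolding zeroV by (rule carI) (simp_all add: Jd(1) homogeneous_def)
    next
      fix X Y assume "X \<in> carrier ?V" "Y \<in> carrier ?V"
      then obtain f g where fg: "f \<in> J" "homogeneous d f" "X = coset I f"
        "g \<in> J" "homogeneous d g" "Y = coset I g" using carE by metis
      show "X \<oplus>\<^bsub>?V\<^esub> Y \<in> carrier ?V"
        unfolding fg addV by (intro carI Jd(2) hom_add fg)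
      show "X \<oplus>\<^bsub>?V\<^esub> Y = Y \<oplus>\<^bsub>?V\<^esub> X"
        unfolding fg addV by (simp only: add.commute)
    next
      fix X Y Z assume "X \<in> carrier ?V" "Y \<in> carrier ?V" "Z \<in> carrier ?V"
      then obtain f g h where fgh: "X = coset I f" "Y = coset I g" "Z = coset I h" using carE by metis
      show "X \<oplus>\<^bsub>?V\<^esub> Y \<oplus>\<^bsub>?V\<^esub> Z = X \<oplus>\<^bsub>?V\<^esub> (Y \<oplus>\<^bsub>?V\<^esub> Z)"
        unfolding fgh addV by (simp only: add.assoc)
    next
      fix X assume "X \<in> carrier ?V"
      then obtain f where f: "f \<in> J" "homogeneous d f" "X = coset I f" using carE by metis
      show "\<zero>\<^bsub>?V\<^esub> \<oplus>\<^bsub>?V\<^esub> X = X" unfolding f zeroV addV by simp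
      have "- f \<in> J" using Jd(3)[OF f(1), of "-1"] by simp
      moreover have "homogeneous d (- f)" using f(2) by (simp add: homogeneous_def in_keys_iff)
      moreover have "coset I (- f) \<oplus>\<^bsub>?V\<^esub> X = \<zero>\<^bsub>?V\<^esub>" unfolding f zeroV addV by simp
      ultimately show "\<exists>Y\<in>carrier ?V. Y \<oplus>\<^bsub>?V\<^esub> X = \<zero>\<^bsub>?V\<^esub>" using carI by blast
    qed
  next
    fix a b :: 'k and X Y assume "X \<in> carrier ?V" "Y \<in> carrier ?V"
    then obtain f g where fg: "f \<in> J" "homogeneous d f" "X = coset I f"
      "g \<in> J" "homogeneous d g" "Y = coset I g" using carE by metis
    show "a \<odot>\<^bsub>?V\<^esub> X \<in> carrier ?V"
      unfolding fg smV by (intro carI Jd(3) hom_const fg)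
    show "(a \<oplus>\<^bsub>class_ring\<^esub> b) \<odot>\<^bsub>?V\<^esub> X = a \<odot>\<^bsub>?V\<^esub> X \<oplus>\<^bsub>?V\<^esub> b \<odot>\<^bsub>?V\<^esub> X"
      unfolding fg smV addV by (simp add: const_add distrib_right)
    show "a \<odot>\<^bsub>?V\<^esub> (X \<oplus>\<^bsub>?V\<^esub> Y) = a \<odot>\<^bsub>?V\<^esub> X \<oplus>\<^bsub>?V\<^esub> a \<odot>\<^bsub>?V\<^esub> Y"
      unfolding fg smV addV by (simp add: distrib_left)
    show "(a \<otimes>\<^bsub>class_ring\<^esub> b) \<odot>\<^bsub>?V\<^esub> X = a \<odot>\<^bsub>?V\<^esub> (b \<odot>\<^bsub>?V\<^esub> X)"
      unfolding fg smV by (simp add: const_times mult.assoc)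
    show "\<one>\<^bsub>class_ring\<^esub> \<odot>\<^bsub>?V\<^esub> X = X"
      unfolding fg smV by (simp add: const_one)
  qed
  then show ?thesis
    by (intro vectorspace.intro class_field)
qed

text \<open>The classes of the monomials in \<open>S\<close> form a basis: \<open>span\<close> makes
  them generate, and \<open>indep\<close>, applied to a linear combination, makes them independent
  as well as pairwise distinct.\<close>

lemma hilbert_fun_eq_card:
  fixes I J :: "('v::finite, 'k::field) mpoly set"
  assumes I: "ideal I class_ring" and J: "ideal J class_ring" and fin: "finite S"
    and deg: "\<And>m. m \<in> S \<Longrightarrow> wdeg UNIV m = d"
    and SJ: "\<And>m. m \<in> S \<Longrightarrow> single m 1 \<in> J"
    and span: "\<And>f. f \<in> J \<Longrightarrow> homogeneous d f \<Longrightarrow> \<exists>g. keys g \<subseteq> S \<and> f - g \<in> I"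
    and indep: "\<And>f. f \<in> I \<Longrightarrow> keys f \<subseteq> S \<Longrightarrow> f = 0"
  shows "hilbert_fun J I d = card S"
proof -
  let ?V = "quotient_component J I d"
  interpret V: vectorspace "class_ring :: 'k ring" ?V
    by (rule quotient_component_vectorspace[OF I J])
  define b where "b m = coset I (single m 1)" for m
  have car: "carrier ?V = coset I ` {f \<in> J. homogeneous d f}"
    by (auto simp: quotient_component_def)
  have addV: "coset I f \<oplus>\<^bsub>?V\<^esub> coset I g = coset I (f + g)" for f g
    by (simp add: quotient_component_def coset_add[OF I])
  have smV: "c \<odot>\<^bsub>?V\<^esub> b m = coset I (single m c)" for c m
    using coset_smult[OF I] by (simp add: quotient_component_def b_def const_def mult_single)
  have zeroV: "\<zero>\<^bsub>?V\<^esub> = coset I 0"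
    by (simp add: quotient_component_def coset_zero[OF I])
  have sm_car: "coset I (single m c) \<in> carrier ?V" if "m \<in> S" for m c
  proof -
    have "single m c = single 0 c * single m (1::'k)" by (simp add: mult_single)
    then have "single m c \<in> J" using ideal_class_ringD(3)[OF J SJ[OF that]] by metis
    moreover have "homogeneous d (single m c)" using deg[OF that] by (simp add: homogeneous_iff)
    ultimately show ?thesis unfolding car by blast
  qed
  have b_car: "b ` S \<subseteq> carrier ?V" using sm_car by (auto simp: b_def)
  have inj: "inj_on b S"
  proof (rule inj_onI)
    fix m m' assume mm: "m \<in> S" "m' \<in> S" "b m = b m'"
    then have "single m 1 - single m' (1::'k) \<in> I" unfolding b_def coset_eq_iff[OF I] by blast
    moreover have "keys (single m 1 - single m' (1::'k)) \<subseteq> S"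
      using mm keys_diff[of "single m 1" "single m' (1::'k)"] by auto
    ultimately have "single m 1 = single m' (1::'k)" using indep by fastforce
    then show "m = m'" by (metis lookup_single_eq lookup_single_not_eq one_neq_zero)
  qed
  have fs: "finsum ?V (\<lambda>m. a m \<odot>\<^bsub>?V\<^esub> b m) T = coset I (\<Sum>m\<in>T. single m (a m))" if "T \<subseteq> S" for T a
    using finite_subset[OF that fin] that
  proof (induction T)
    case empty
    then show ?case using zeroV by simp
  next
    case (insert m T)
    then show ?case using sm_car
      by (subst V.finsum_insert) (auto simp: smV addV)
  qed
  have lc: "V.lincomb a (b ` S) = coset I (\<Sum>m\<in>S. single m (a (b m)))" for a
    unfolding V.lincomb_def using fs[OF subset_refl, of "\<lambda>m. a (b m)"] sm_car
    by (subst V.finsum_reindex[OF _ inj]) (auto simp: smV)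
  have keys_sum: "lookup (\<Sum>m\<in>S. single m (a m)) m' = (if m' \<in> S then a m' else 0)" for a :: "_ \<Rightarrow> 'k" and m'
    using fin by (simp add: lookup_sum lookup_single when_def)
  have "V.lin_indpt (b ` S)"
  proof
    assume "V.lin_dep (b ` S)"
    then obtain a v where a: "V.lincomb a (b ` S) = \<zero>\<^bsub>?V\<^esub>" "v \<in> b ` S" "a v \<noteq> 0"
      using V.finite_lin_dep[OF finite_imageI[OF fin] _ b_car] by auto
    have "(\<Sum>m\<in>S. single m (a (b m))) \<in> I"
      using a(1) unfolding lc zeroV coset_eq_iff[OF I] by simp
    moreover have "keys (\<Sum>m\<in>S. single m (a (b m))) \<subseteq> S"
      using keys_sum by (auto simp: in_keys_iff split: if_splits)
    ultimately have "(\<Sum>m\<in>S. single m (a (b m))) = 0" by (rule indep)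
    then show False using a(2,3) keys_sum[of "\<lambda>m. a (b m)"] by (metis imageE lookup_zero)
  qed
  moreover have "carrier ?V \<subseteq> V.span (b ` S)"
  proof
    fix X assume "X \<in> carrier ?V"
    then obtain f where f: "f \<in> J" "homogeneous d f" "X = coset I f" using car by blast
    then obtain g where g: "keys g \<subseteq> S" "f - g \<in> I" using span by blast
    \<comment> \<open>Linear combinations take coefficients indexed by basis vectors, which are
      cosets here; \<open>the_inv_into\<close> recovers the monomial from its class.\<close>
    define a where "a Y = lookup g (the_inv_into S b Y)" for Y
    have "g = (\<Sum>m\<in>S. single m (a (b m)))"
      using g(1) by (intro poly_mapping_eqI)
        (auto simp: keys_sum a_def the_inv_into_f_f[OF inj] in_keys_iff)
    then have "X = V.lincomb a (b ` S)" unfolding lc f(3) using coset_eq_iff[OF I] g(2) by simp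
    then show "X \<in> V.span (b ` S)"
      unfolding V.span_def using fin by auto
  qed
  ultimately have "V.basis (b ` S)"
    unfolding V.basis_def using b_car V.span_is_subset2[OF b_car] by auto
  then have "V.dim = card (b ` S)" by (intro V.dim_basis finite_imageI fin)
  then show ?thesis unfolding hilbert_fun_def card_image[OF inj] .
qed

section \<open>From unicyclic graphs to whiskered cycles\<close>

lemma successively_nth:
  "successively P ys \<Longrightarrow> Suc k < length ys \<Longrightarrow> P (ys ! k) (ys ! Suc k)"
proof (induction ys arbitrary: k)
  case (Cons y ys)
  then show ?case by (cases k) (auto simp: successively_Cons hd_conv_nth)
qed simp

lemma is_cycleI:
  assumes "3 \<le> length ys" "distinct ys" "successively (\<lambda>a b. {a, b} \<in> E) ys" "{last ys, hd ys} \<in> E"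
  shows "is_cycle E ys" and "{last ys, hd ys} \<in> cycle_edges ys"
proof -
  have ne: "ys \<noteq> []" using assms(1) by auto
  have "{ys ! k, ys ! ((k + 1) mod length ys)} \<in> E" if k: "k < length ys" for k
  proof (cases "Suc k < length ys")
    case True
    then show ?thesis using successively_nth[OF assms(3)] by simp
  next
    case False
    then have "Suc k = length ys" using k by simp
    then show ?thesis using assms(4) ne by (simp add: last_conv_nth hd_conv_nth flip: \<open>Suc k = length ys\<close>)
  qed
  then show "is_cycle E ys" unfolding is_cycle_def cycle_edges_def using assms(1,2) by auto
  show "{last ys, hd ys} \<in> cycle_edges ys"
    unfolding cycle_edges_def using ne
    by (intro CollectI exI[of _ "length ys - 1"]) (simp add: last_conv_nth hd_conv_nth)
qed

locale unicyclic_near_cycle =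
  fixes E :: "'v::finite set set" and xs :: "'v list" and n :: nat
  assumes uni: "unicyclic E" and n: "1 \<le> n" and cyc: "is_cycle E xs" and len: "length xs = 2 * n + 1"
    and near: "\<forall>v. v \<in> closed_nbhd E (set xs)"
begin

lemma distinct_xs: "distinct xs" and cycle_edges_subset: "cycle_edges xs \<subseteq> E"
  using cyc by (auto simp: is_cycle_def)

lemma simple: "e \<in> E \<Longrightarrow> card e = 2"
  using uni by (auto simp: unicyclic_def simple_graph_def)

lemma cycle_unique: "is_cycle E ys \<Longrightarrow> cycle_edges ys = cycle_edges xs"
  using uni cyc unfolding unicyclic_def by blast

definition x :: "nat \<Rightarrow> 'v" where
  "x i = xs ! (i mod (2 * n + 1))"

lemma x_nth: "i \<le> 2 * n \<Longrightarrow> x i = xs ! i"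
  by (simp add: x_def)

lemma range_x: "range x = set xs"
proof
  show "set xs \<subseteq> range x"
  proof
    fix v assume "v \<in> set xs"
    then obtain i where "i < 2 * n + 1" "v = xs ! i" using len by (metis in_set_conv_nth)
    then show "v \<in> range x" using x_nth[of i] by (metis rangeI less_Suc_eq_le Suc_eq_plus1)
  qed
qed (auto simp: x_def len)

lemma inj_x: "inj_on x {..2 * n}"
  using distinct_xs len by (intro inj_onI) (auto simp: x_nth nth_eq_iff_index_eq)

lemma cycle_edges_eq: "cycle_edges xs = (\<lambda>i. {x i, x (Suc i)}) ` {..2 * n}"
proof -
  have "{xs ! i, xs ! ((i + 1) mod length xs)} = {x i, x (Suc i)}" if "i < length xs" for i
    using that len by (simp add: x_def)
  then show ?thesis unfolding cycle_edges_def using len by (auto simp: less_Suc_eq_le)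
qed

lemma x_Suc_mem_cycle_edges: "{x i, x (Suc i)} \<in> cycle_edges xs"
proof -
  have "x (i mod (2 * n + 1)) = x i" "x (Suc (i mod (2 * n + 1))) = x (Suc i)"
    by (simp_all add: x_def mod_Suc_eq)
  moreover have "i mod (2 * n + 1) \<in> {..2 * n}"
    using mod_less_divisor[of "2 * n + 1" i] by (simp del: mod_less_divisor)
  ultimately show ?thesis unfolding cycle_edges_eq by (metis (no_types, lifting) image_eqI)
qed

text \<open>The arc \<open>x i, \<dots>, x j\<close> closed up by a path through the outside vertices \<open>q\<close> would be a
  second cycle.\<close>

lemma closed_arc_imp_cycle_edge:
  assumes ij: "i \<le> j" "j \<le> 2 * n" and q: "distinct q" "set q \<inter> set xs = {}" "2 \<le> j - i + length q"
    and path: "successively (\<lambda>a b. {a, b} \<in> E) (x j # q)" "{last (x j # q), x i} \<in> E"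
  shows "{last (x j # q), x i} \<in> cycle_edges xs"
proof -
  define ys where "ys = map x [i..<j] @ x j # q"
  have arc: "successively (\<lambda>a b. {a, b} \<in> E) (map x [i..<j])"
  proof (induction j)
    case (Suc j)
    show ?case
    proof (cases "i < j")
      case True
      then show ?thesis
        using Suc x_Suc_mem_cycle_edges[of "j - 1"] cycle_edges_subset
        by (auto simp: successively_append_iff last_map)
    next
      case False
      then show ?thesis by (cases "i = j") auto
    qed
  qed simp
  have hd: "hd ys = x i" using ij by (cases "i = j") (auto simp: ys_def hd_map)
  have last: "last ys = last (x j # q)" by (simp add: ys_def)
  have "inj_on x (set [i..<Suc j])"
    by (rule inj_on_subset[OF inj_x]) (use ij in auto)
  then have "distinct (map x [i..<Suc j])" by (simp add: distinct_map del: upt_Suc)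
  then have "distinct (map x [i..<j] @ [x j])" using ij(1) by simp
  moreover have "set (map x [i..<j] @ [x j]) \<subseteq> set xs" using range_x by auto
  ultimately have "distinct ys" using q unfolding ys_def by auto
  moreover have "successively (\<lambda>a b. {a, b} \<in> E) ys"
    unfolding ys_def successively_append_iff
    using arc path(1) x_Suc_mem_cycle_edges[of "j - 1"] cycle_edges_subset
    by (cases "i < j") (auto simp: last_map)
  moreover have "3 \<le> length ys" using q(3) by (simp add: ys_def)
  ultimately show ?thesis
    using is_cycleI[of ys E] path(2) cycle_unique[of ys] unfolding hd last by simp
qed

lemma cycle_edge_subset: "e \<in> cycle_edges xs \<Longrightarrow> e \<subseteq> set xs"
  unfolding cycle_edges_eq using range_x by auto

lemma index_ex: "v \<in> set xs \<Longrightarrow> \<exists>i\<le>2 * n. v = x i"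
  using len by (metis in_set_conv_nth x_nth less_Suc_eq_le Suc_eq_plus1)

text \<open>Case \<open>q = []\<close>: if the ends are not consecutive in the list, the arc between
  them has at least three vertices, and the chord closes it to a cycle, which can only be the given
  one.\<close>

lemma chord:
  assumes "{a, b} \<in> E" "a \<in> set xs" "b \<in> set xs"
  shows "{a, b} \<in> cycle_edges xs"
proof -
  have ord: "{x i, x j} \<in> cycle_edges xs" if "i < j" "j \<le> 2 * n" "{x i, x j} \<in> E" for i j
  proof (cases "j = Suc i")
    case False
    then show ?thesis
      using closed_arc_imp_cycle_edge[of i j "[]"] that by (simp add: insert_commute)
  qed (simp add: x_Suc_mem_cycle_edges)
  obtain i j where ij: "i \<le> 2 * n" "a = x i" "j \<le> 2 * n" "b = x j" using assms index_ex by metis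
  then have "i \<noteq> j" using simple[OF assms(1)] by auto
  then show ?thesis using ord[of i j] ord[of j i] ij assms(1) by (cases "i < j") (auto simp: insert_commute)
qed

text \<open>Case \<open>q = [y]\<close>: two neighbours on the cycle would make an edge at
  \<open>y\<close> a cycle edge, although \<open>y\<close> is off the cycle.\<close>

lemma outside_unique:
  assumes y: "y \<notin> set xs" "{y, a} \<in> E" "a \<in> set xs" "{y, b} \<in> E" "b \<in> set xs"
  shows "a = b"
proof -
  have False if "i < j" "j \<le> 2 * n" "{y, x i} \<in> E" "{y, x j} \<in> E" for i j
    using closed_arc_imp_cycle_edge[of i j "[y]"] that y(1) cycle_edge_subset[of "{y, x i}"]
    by (auto simp: insert_commute)
  then show ?thesis using index_ex[OF y(3)] index_ex[OF y(5)] y(2,4) by (metis nat_neq_iff)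
qed

lemma outside_neighbour:
  assumes "y \<notin> set xs"
  obtains i where "i \<le> 2 * n" "{y, x i} \<in> E"
proof -
  have "y \<in> closed_nbhd E (set xs)" using near by blast
  then obtain w where "w \<in> set xs" "{y, w} \<in> E" using assms unfolding closed_nbhd_def by auto
  then show thesis using index_ex[of w] that by auto
qed

text \<open>Two adjacent outside vertices would each have a neighbour on the cycle. Even if these
  coincide, with \<open>i = j\<close>, a triangle arises, so the bound of three vertices is met in
  all cases.\<close>

lemma outside_independent:
  assumes "y \<notin> set xs" "w \<notin> set xs"
  shows "{y, w} \<notin> E"
proof
  assume yw: "{y, w} \<in> E"
  then have "y \<noteq> w" using simple by fastforce
  have out: False
    if "i \<le> j" "j \<le> 2 * n" "{y, x i} \<in> E" "{w, x j} \<in> E" "y \<notin> set xs" "w \<notin> set xs" "{y, w} \<in> E" "y \<noteq> w"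
    for i j y w
    using closed_arc_imp_cycle_edge[of i j "[w, y]"] that cycle_edge_subset[of "{y, x i}"]
    by (auto simp: insert_commute)
  obtain i where i: "i \<le> 2 * n" "{y, x i} \<in> E" by (rule outside_neighbour[OF assms(1)])
  obtain j where j: "j \<le> 2 * n" "{w, x j} \<in> E" by (rule outside_neighbour[OF assms(2)])
  have "{w, y} \<in> E" using yw by (simp add: insert_commute)
  then show False using out[of i j y w] out[of j i w y] i j yw \<open>y \<noteq> w\<close> assms
    by (cases "i \<le> j") auto
qed

sublocale whiskered_odd_cycle E x n
proof
  show "x (i + (2 * n + 1)) = x i" for i by (simp only: x_def mod_add_self2)
  show "{x i, x (Suc i)} \<in> E" for i
    by (rule subsetD[OF cycle_edges_subset x_Suc_mem_cycle_edges])
  fix e assume e: "e \<in> E"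
  obtain a b where ab: "e = {a, b}" using simple[OF e] by (auto simp: card_2_iff)
  consider "a \<in> set xs" "b \<in> set xs" | "a \<notin> set xs" "b \<in> set xs" | "a \<in> set xs" "b \<notin> set xs"
    using outside_independent e ab by blast
  then show "(\<exists>i. e = {x i, x (Suc i)}) \<or> (\<exists>y i. y \<notin> range x \<and> e = {y, x i})"
  proof cases
    case 1
    then have "e \<in> cycle_edges xs" using chord[of a b] e ab by simp
    then show ?thesis unfolding cycle_edges_eq by blast
  next
    case 2
    then show ?thesis using index_ex ab range_x by metis
  next
    case 3
    then show ?thesis using index_ex ab range_x by (metis insert_commute)
  qed
next
  fix y u u' assume y: "y \<notin> range x" "{y, u} \<in> E" "{y, u'} \<in> E"
  then show "u = u'" using outside_unique[of y u u'] outside_independent unfolding range_x by blast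
next
  fix y assume "y \<notin> range x"
  then show "\<exists>i. {y, x i} \<in> E" using outside_neighbour[of y] by (metis range_x)
qed (use n inj_x in auto)

text \<open>Two indices could give the same edge in reverse only if a vertex were its own second
  successor, which a cycle of length at least three excludes.\<close>

lemma card_cycle_edges: "card (cycle_edges xs) = 2 * n + 1"
proof -
  have "inj_on (\<lambda>i. {x i, x (Suc i)}) {..2 * n}"
  proof (rule inj_onI)
    fix i j assume ij: "i \<in> {..2 * n}" "j \<in> {..2 * n}" "{x i, x (Suc i)} = {x j, x (Suc j)}"
    then consider "x i = x j" | "x i = x (Suc j)" "x (Suc i) = x j" by (auto simp: doubleton_eq_iff)
    then show "i = j"
    proof cases
      case 2
      then have "x (Suc i) = x (Suc (Suc j))" using x_Suc_eq_iff by blast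
      then show ?thesis using 2 x_add2_neq[of j] by simp
    qed (use ij inj_x in \<open>auto simp: inj_on_def\<close>)
  qed
  then show ?thesis unfolding cycle_edges_eq by (simp add: card_image)
qed

lemma card_E: "card E = 2 * n + 1 + card (E - cycle_edges xs)"
  using card_Diff_subset[OF _ cycle_edges_subset] card_mono[OF _ cycle_edges_subset] card_cycle_edges by simp

end

section \<open>The Hilbert function\<close>

context whiskered_odd_cycle
begin

text \<open>The monomials of the symbolic power that lie outside the ordinary power, in degree \<open>d\<close>.\<close>

definition extra_monomials :: "nat \<Rightarrow> nat \<Rightarrow> ('v \<Rightarrow>\<^sub>0 nat) set" where
  "extra_monomials s d = {m. wdeg UNIV m = d \<and> (\<exists>j A. 1 \<le> j \<and> set_mset A \<subseteq> E \<and>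
     size A + j * (n + 1) = s \<and> m = mset_mono (replicate_mset j (range x)) + mset_mono A)}"

text \<open>A cycle counts for \<open>n + 1\<close> edges but has degree \<open>2 * n + 1\<close>
  instead of \<open>2 * n + 2\<close>, a deficit of one per cycle. The additive form avoids
  truncated subtraction.\<close>

lemma degree_extra:
  assumes "set_mset A \<subseteq> E" "size A + j * (n + 1) = s"
  shows "wdeg UNIV (mset_mono (replicate_mset j (range x)) + mset_mono A) + j = 2 * s"
  using assms(2) by (simp add: degree_mset_mono[OF assms(1)] degree_cycle_power flip: assms(2))

text \<open>Independence is a matter of degree: terms of the ordinary power have degree at least
  \<open>2 * s\<close>, the extra monomials have less, so no nonzero polynomial is built from
  both.\<close>

lemma hilbert_fun_eq_card_extra:
  assumes fin: "finite (extra_monomials s d)"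
  shows "hilbert_fun (symbolic_power (edge_ideal E :: ('v, 'k::field) mpoly set) s)
    (ideal_power (edge_ideal E) s) d = card (extra_monomials s d)"
proof (rule hilbert_fun_eq_card[OF _ _ fin])
  let ?S = "extra_monomials s d"
  show id: "ideal (ideal_power (edge_ideal E :: ('v, 'k) mpoly set) s) class_ring"
    by (rule ideal_ideal_power[OF ideal_edge_ideal])
  show "ideal (symbolic_power (edge_ideal E :: ('v, 'k) mpoly set) s) class_ring"
    by (rule ideal_symbolic_power[OF ideal_edge_ideal])
  show "wdeg UNIV m = d" if "m \<in> ?S" for m
    using that by (simp add: extra_monomials_def)
  show "(single m 1 :: ('v, 'k) mpoly) \<in> symbolic_power (edge_ideal E) s" if "m \<in> ?S" for m
    using that monomial_mem_symbolic_power unfolding extra_monomials_def by blast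
  show "\<exists>g. keys g \<subseteq> ?S \<and> f - g \<in> ideal_power (edge_ideal E) s"
    if f: "f \<in> symbolic_power (edge_ideal E) s" "homogeneous d f" for f :: "('v, 'k) mpoly"
  proof -
    define g where "g = (\<Sum>m\<in>?S. single m (lookup f m))"
    have g: "lookup g m = (if m \<in> ?S then lookup f m else 0)" for m
      using fin by (simp add: g_def lookup_sum lookup_single when_def)
    have "edge_product_divides E s m" if m: "m \<in> keys (f - g)" for m
    proof -
      have "m \<in> keys f" "m \<notin> ?S"
        using m g[of m] by (auto simp: in_keys_iff lookup_minus split: if_splits)
      then show ?thesis
        using symbolic_power_keys[OF f(1)] f(2) unfolding extra_monomials_def homogeneous_iff by blast
    qed
    then have "f - g \<in> ideal_power (edge_ideal E) s"
      unfolding ideal_power_edge_ideal[OF simple_graph_E] by blast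
    moreover have "keys g \<subseteq> ?S" using g by (auto simp: in_keys_iff split: if_splits)
    ultimately show ?thesis by blast
  qed
  show "f = 0" if f: "f \<in> ideal_power (edge_ideal E) s" "keys f \<subseteq> ?S" for f :: "('v, 'k) mpoly"
  proof (rule ccontr)
    assume "f \<noteq> 0"
    then obtain m where m: "m \<in> keys f" by (metis keys_eq_empty ex_in_conv)
    obtain B m' where "set_mset B \<subseteq> E" "size B = s" "m = mset_mono B + m'"
      using f(1) m unfolding ideal_power_edge_ideal[OF simple_graph_E] edge_product_divides_def by blast
    then have ge: "2 * s \<le> wdeg UNIV m" by (simp add: degree_mset_mono)
    obtain j A where "1 \<le> j" "set_mset A \<subseteq> E" "size A + j * (n + 1) = s"
      "m = mset_mono (replicate_mset j (range x)) + mset_mono A"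
      using f(2) m unfolding extra_monomials_def by blast
    then show False using degree_extra[of A j s] ge by simp
  qed
qed

lemma extra_monomials_eq:
  assumes "1 \<le> j" "j * (n + 1) \<le> s"
  shows "extra_monomials s (2 * s - j) =
    (\<lambda>A. mset_mono (replicate_mset j (range x)) + mset_mono A) ` multisets_of_size E (s - j * (n + 1))"
proof (intro equalityI subsetI)
  \<comment> \<open>Makes \<open>2 * s - j\<close> a genuine difference, so that the degree
    determines the number of cycles.\<close>
  have js: "j \<le> 2 * s" using assms(2) by simp
  fix m assume "m \<in> extra_monomials s (2 * s - j)"
  then obtain i A where A: "wdeg UNIV m = 2 * s - j" "set_mset A \<subseteq> E" "size A + i * (n + 1) = s"
    "m = mset_mono (replicate_mset i (range x)) + mset_mono A"
    unfolding extra_monomials_def by blast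
  then have "i = j" using degree_extra[OF A(2,3)] js by simp
  then show "m \<in> (\<lambda>A. mset_mono (replicate_mset j (range x)) + mset_mono A) ` multisets_of_size E (s - j * (n + 1))"
    using A by (intro image_eqI[of _ _ A]) (auto simp: multisets_of_size_def)
next
  fix m assume "m \<in> (\<lambda>A. mset_mono (replicate_mset j (range x)) + mset_mono A) ` multisets_of_size E (s - j * (n + 1))"
  then obtain A where A: "set_mset A \<subseteq> E" "size A = s - j * (n + 1)"
    "m = mset_mono (replicate_mset j (range x)) + mset_mono A"
    by (auto simp: multisets_of_size_def)
  then have s: "size A + j * (n + 1) = s" using assms(2) by simp
  then have "wdeg UNIV m = 2 * s - j" using degree_extra[OF A(1) s] A(3) by simp
  then show "m \<in> extra_monomials s (2 * s - j)"
    unfolding extra_monomials_def using A s assms(1) by blast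
qed

text \<open>Once \<open>j\<close> is fixed, the common cycle factor cancels and unique factorization
  leaves a count of edge multisets of given size.\<close>

lemma hilbert_fun_exceptional_degree:
  assumes "1 \<le> j" "j * (n + 1) \<le> s"
  shows "hilbert_fun (symbolic_power (edge_ideal E :: ('v, 'k::field) mpoly set) s)
    (ideal_power (edge_ideal E) s) (2 * s - j)
    = (card E + (s - j * (n + 1)) - 1) choose (s - j * (n + 1))"
proof -
  have "inj_on (\<lambda>A. mset_mono (replicate_mset j (range x)) + mset_mono A) (multisets_of_size E t)" for t
    using inj_on_mset_mono by (auto simp: inj_on_def multisets_of_size_def)
  then show ?thesis
    by (simp add: hilbert_fun_eq_card_extra extra_monomials_eq[OF assms] card_image
        card_multisets_of_size finite_multisets_of_size)
qed

lemma hilbert_fun_other_degree: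
  assumes "\<And>j. 1 \<le> j \<Longrightarrow> j * (n + 1) \<le> s \<Longrightarrow> d \<noteq> 2 * s - j"
  shows "hilbert_fun (symbolic_power (edge_ideal E :: ('v, 'k::field) mpoly set) s)
    (ideal_power (edge_ideal E) s) d = 0"
proof -
  have "m \<notin> extra_monomials s d" for m
  proof
    assume "m \<in> extra_monomials s d"
    then obtain j A where A: "wdeg UNIV m = d" "1 \<le> j" "set_mset A \<subseteq> E" "size A + j * (n + 1) = s"
      "m = mset_mono (replicate_mset j (range x)) + mset_mono A"
      unfolding extra_monomials_def by blast
    then have "d = 2 * s - j" using degree_extra[OF A(3,4)] by simp
    then show False using assms[of j] A(2,4) by simp
  qed
  then have "extra_monomials s d = {}" by blast
  then show ?thesis by (simp add: hilbert_fun_eq_card_extra)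
qed

end

theorem theorem5p4:
  fixes E :: "'v::finite set set" and xs :: "'v list"
    and I :: "('v, 'k::field) mpoly set"
    and n l s k r :: nat and h :: "nat \<Rightarrow> nat"
  assumes "unicyclic E"
    and "n \<ge> 1" and "is_cycle E xs" and "length xs = 2 * n + 1"
    and "\<forall>v. v \<in> closed_nbhd E (set xs)"
    and "I = edge_ideal E"
    and "l = card (E - cycle_edges xs)"
    and "s \<ge> n + 1" and "s = k * (n + 1) + r" and "r \<le> n"
    and "h = hilbert_fun (symbolic_power I s) (ideal_power I s)"
  shows "(\<forall>i<k. h (2 * s - k + i) =
             (2 * n + l + s - (k - i) * (n + 1)) choose (s - (k - i) * (n + 1)))
       \<and> (\<forall>d. (\<forall>i<k. d \<noteq> 2 * s - k + i) \<longrightarrow> h d = 0)"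
proof -
  interpret unicyclic_near_cycle E xs n
    using assms by unfold_locales auto
  have ks: "k \<le> s" using assms(9) by simp
  show ?thesis
  proof (intro conjI allI impI)
    fix i assume "i < k"
    \<comment> \<open>Degree \<open>2 * s - k + i\<close> is the one with \<open>k - i\<close>
      cycles: the index \<open>i\<close> counts the cycles downwards from the maximal number
      \<open>k\<close>.\<close>
    define j where "j = k - i"
    have j: "1 \<le> j" "j \<le> k" "2 * s - k + i = 2 * s - j"
      using \<open>i < k\<close> ks by (auto simp: j_def)
    have "j * (n + 1) \<le> k * (n + 1)" using j(2) by (rule mult_le_mono1)
    then have js: "j * (n + 1) \<le> s" using assms(9) by linarith
    \<comment> \<open>There are \<open>2 * n + 1 + l\<close> edges; the one subtracted in the
      multiset count leaves \<open>2 * n + l\<close>.\<close>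
    have "card E + (s - j * (n + 1)) - 1 = 2 * n + l + s - j * (n + 1)"
      using card_E assms(7) js by linarith
    then show "h (2 * s - k + i) =
        (2 * n + l + s - (k - i) * (n + 1)) choose (s - (k - i) * (n + 1))"
      using hilbert_fun_exceptional_degree[OF j(1) js, where 'k = 'k]
      unfolding assms(11,6) j(3) j_def[symmetric] by simp
  next
    fix d assume d: "\<forall>i<k. d \<noteq> 2 * s - k + i"
    have "d \<noteq> 2 * s - j" if "1 \<le> j" "j * (n + 1) \<le> s" for j
    proof -
      \<comment> \<open>At most \<open>k\<close> cycles fit, because \<open>r \<le> n\<close> gives
        \<open>s < (k + 1) * (n + 1)\<close>.\<close>
      have "j < k + 1"
      proof (rule ccontr)
        assume "\<not> j < k + 1"
        then have "(k + 1) * (n + 1) \<le> j * (n + 1)" by (intro mult_le_mono1) simp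
        also note that(2)
        finally show False using assms(9,10) by simp
      qed
      moreover from this have "2 * s - k + (k - j) = 2 * s - j" using ks by simp
      ultimately show ?thesis using d[rule_format, of "k - j"] that(1) by simp
    qed
    then show "h d = 0"
      unfolding assms(11,6) by (rule hilbert_fun_other_degree)
  qed
qed

end
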